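(* Let $(E,[\![\cdot,\cdot]\!],\rho,\alpha)$ be a Loday algebroid over $M$, $\nabla$ a nonlinear $E$-connection on a trivial real line bundle $\mathbb L$ over $M$, $s$ a nonvanishing section of $\mathbb L$, and $\theta_s\in\mathcal D^1(\mathcal E)$ the connection $1$-differential operator of $\nabla$ relative to $s$, i.e. $\nabla_es=\theta_s(e)s$ for all $e\in\Gamma(E)$. 1. $R^\nabla=\partial_E\theta_s$ (that is, $R^\nabla(e_1,e_2)s=(\partial_E\theta_s)(e_1,e_2)\,s$). Thus $\mathbb L$ is a representation of $E$ (with respect to $\nabla$) if and only if $\theta_s$ is a $1$-cocycle with respect to $\partial_E$. 2. If $s'$ is another nonvanishing section of $\mathbb L$, then $s'=fs$ for a nonvanishing function $f\in C^\infty(M,\mathbb R)$, and $\theta_{s'}=\theta_s+\partial_E\ln|f|$. Therefore, if $\mathbb L$ is a representation of $E$, the class $[\theta_s]\in H^1(\mathcal E)$ is well defined and independent of the chosen nonvanishing section $s$.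
   Context: A Loday algebroid $(E,[\![\cdot,\cdot]\!],\rho,\alpha)$ over a smooth manifold $M$ consists of a vector bundle $E\to M$ of constant rank, an $\mathbb R$-bilinear bracket $[\![\cdot,\cdot]\!]$ on $\Gamma(E)$ (not necessarily skew-symmetric) with $[\![e_1,[\![e_2,e_3]\!]]\!]=[\![[\![e_1,e_2]\!],e_3]\!]+[\![e_2,[\![e_1,e_3]\!]]\!]$, and vector bundle morphisms over $\mathrm{id}_M$, $\rho:E\to TM$ and $\alpha:T^*M\otimes E\to\mathrm{End}(E)$, with $[\![e_1,fe_2]\!]=f[\![e_1,e_2]\!]+\rho(e_1)(f)e_2$ and $[\![fe_1,e_2]\!]=f[\![e_1,e_2]\!]-\rho(e_2)(f)e_1+\alpha(df\otimes e_1)(e_2)$. (Then $\rho([\![e_1,e_2]\!])=[\rho(e_1),\rho(e_2)]$.) Put $\mathcal E=\Gamma(E)$. $\mathcal D^p(\mathcal E)$ is the space of $\mathbb R$-multilinear maps $\mathcal E^p\to C^\infty(M,\mathbb R)$ that are differential operators in each argument, $\mathcal D^0(\mathcal E)=C^\infty(M,\mathbb R)$. The operator $\partial_E:\mathcal D^p(\mathcal E)\to\mathcal D^{p+1}(\mathcal E)$, $$\partial_ED(e_1,\dots,e_{p+1})=\sum_i(-1)^{i+1}\rho(e_i)D(\dots,\hat e_i,\dots)+\sum_{i<j}(-1)^iD(e_1,\dots,\hat e_i,\dots,\hat e_j,[\![e_i,e_j]\!],e_{j+1},\dots,e_{p+1}),$$ (so $\partial_Ef(e)=\rho(e)(f)$)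 satisfies $\partial_E^2=0$; its cohomology is $H^\bullet(\mathcal E)$. A nonlinear $E$-connection on a vector bundle $B\to M$ is an $\mathbb R$-bilinear map $\nabla:\Gamma(E)\times\Gamma(B)\to\Gamma(B)$ with $\nabla_e(fb)=f\nabla_eb+\rho(e)(f)b$ and $\nabla_{fe}b=f\nabla_eb+\sigma(df\otimes e)(b)$ for some vector bundle map $\sigma:T^*M\otimes E\to\mathrm{End}(B)$. Its curvature is $R^\nabla(e_1,e_2)=\nabla_{e_1}\nabla_{e_2}-\nabla_{e_2}\nabla_{e_1}-\nabla_{[\![e_1,e_2]\!]}$; $B$ is a representation of $E$ with respect to $\nabla$ if $R^\nabla=0$. *)

theory Defs
  imports "HOL-Analysis.Analysis" "HOL-Library.Function_Algebras"
begin

section \<open>Linear algebra\<close>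

instantiation "fun" :: (type, real_vector) real_vector
begin

definition scaleR_fun :: "real \<Rightarrow> ('a \<Rightarrow> 'b) \<Rightarrow> 'a \<Rightarrow> 'b"
  where "scaleR_fun c f = (\<lambda>x. c *\<^sub>R f x)"

instance
  by standard (simp_all add: scaleR_fun_def fun_eq_iff scaleR_add_right scaleR_add_left)

end

text \<open>
  Model spaces of manifolds and typical fibres of vector bundles.  Unlike \<^class>\<open>euclidean_space\<close>,
  this class admits the zero space, so manifolds of dimension 0 and bundles of rank 0 are included.
\<close>

class finite_dim_normed_vector = real_normed_vector +
  assumes finite_dim: "\<exists>B. finite B \<and> (\<forall>v. \<exists>c. v = (\<Sum>b\<in>B. scaleR (c b) b))"

instance euclidean_space \<subseteq> finite_dim_normed_vector
proof
  show "\<exists>B::'a set. finite B \<and> (\<forall>v. \<exists>c. v = (\<Sum>b\<in>B. scaleR (c b) b))"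
    by (intro exI[of _ Basis] conjI allI finite_Basis)
      (rule exI, rule euclidean_representation[symmetric])
qed

definition linear_map_on :: "'a::real_vector set \<Rightarrow> 'b::real_vector set \<Rightarrow> ('a \<Rightarrow> 'b) \<Rightarrow> bool"
  where "linear_map_on V W L \<longleftrightarrow>
    (\<forall>v\<in>V. L v \<in> W) \<and>
    (\<forall>u\<in>V. \<forall>v\<in>V. L (u + v) = L u + L v) \<and>
    (\<forall>c. \<forall>v\<in>V. L (c *\<^sub>R v) = c *\<^sub>R L v)"

definition bilinear_map_on ::
  "'a::real_vector set \<Rightarrow> 'b::real_vector set \<Rightarrow> 'c::real_vector set \<Rightarrow> ('a \<Rightarrow> 'b \<Rightarrow> 'c) \<Rightarrow> bool"
  where "bilinear_map_on U V W \<beta> \<longleftrightarrow>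
    (\<forall>u\<in>U. linear_map_on V W (\<beta> u)) \<and> (\<forall>v\<in>V. linear_map_on U W (\<lambda>u. \<beta> u v))"


section \<open>Smooth manifolds\<close>

text \<open>
  \<open>Ck_on k S f\<close>: on the open set \<open>S\<close> of a finite-dimensional space, \<open>f\<close> is \<open>k\<close> times continuously
  differentiable (all iterated directional derivatives exist and are continuous).
\<close>

primrec Ck_on :: "nat \<Rightarrow> 'a::real_normed_vector set \<Rightarrow> ('a \<Rightarrow> 'b::real_normed_vector) \<Rightarrow> bool"
  where
    "Ck_on 0 S f \<longleftrightarrow> continuous_on S f"
  | "Ck_on (Suc k) S f \<longleftrightarrow>
      (\<forall>x\<in>S. f differentiable (at x)) \<and> (\<forall>v. Ck_on k S (\<lambda>x. frechet_derivative f (at x) v))"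

definition smooth_on :: "'a::real_normed_vector set \<Rightarrow> ('a \<Rightarrow> 'b::real_normed_vector) \<Rightarrow> bool"
  where "smooth_on S f \<longleftrightarrow> (\<forall>k. Ck_on k S f)"

type_synonym ('m, 'c) chart = "'m set \<times> ('m \<Rightarrow> 'c)"

type_synonym ('m, 'c) tvector = "('m, 'c) chart \<Rightarrow> 'c"

type_synonym ('m, 'c) covector = "('m, 'c) tvector \<Rightarrow> real"

type_synonym ('a, 'b) tensors = "('a \<Rightarrow> 'b \<Rightarrow> real) \<Rightarrow> real"

definition chart_inv :: "('m, 'c) chart \<Rightarrow> 'c \<Rightarrow> 'm"
  where "chart_inv \<kappa> = inv_into (fst \<kappa>) (snd \<kappa>)"

text \<open>
  The manifold is the whole type \<open>'m\<close>, Hausdorff and second countable by its sort, with a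
  (not necessarily maximal) smooth atlas.
\<close>

definition smooth_manifold ::
  "('m::{t2_space, second_countable_topology}, 'c::finite_dim_normed_vector) chart set \<Rightarrow> bool"
  where "smooth_manifold A \<longleftrightarrow>
    (\<Union>\<kappa>\<in>A. fst \<kappa>) = UNIV \<and>
    (\<forall>\<kappa>\<in>A. open (fst \<kappa>) \<and> open (snd \<kappa> ` fst \<kappa>) \<and>
      homeomorphism (fst \<kappa>) (snd \<kappa> ` fst \<kappa>) (snd \<kappa>) (chart_inv \<kappa>)) \<and>
    (\<forall>\<kappa>\<in>A. \<forall>\<kappa>'\<in>A. smooth_on (snd \<kappa> ` (fst \<kappa> \<inter> fst \<kappa>')) (snd \<kappa>' \<circ> chart_inv \<kappa>))"

definition smooth_map_on ::
  "('m, 'c::real_normed_vector) chart set \<Rightarrow> 'm set \<Rightarrow> ('m \<Rightarrow> 'b::real_normed_vector) \<Rightarrow> bool"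
  where "smooth_map_on A U f \<longleftrightarrow>
    (\<forall>\<kappa>\<in>A. smooth_on (snd \<kappa> ` (U \<inter> fst \<kappa>)) (f \<circ> chart_inv \<kappa>))"

definition smooth_functions :: "('m, 'c::real_normed_vector) chart set \<Rightarrow> ('m \<Rightarrow> real) set"
  where "smooth_functions A = {f. smooth_map_on A UNIV f}"


section \<open>Vector bundles\<close>

text \<open>
  The fibre over \<open>x\<close> is a subspace \<open>fib B x\<close> of \<open>'e\<close>; the total space is the disjoint union of the
  fibres.  A local trivialization over \<open>U\<close> is a pair \<open>(U, \<Phi>)\<close>, where \<open>\<Phi> x\<close> identifies the fibre
  over \<open>x \<in> U\<close> with the typical fibre \<open>'f\<close>.  The topology and the smooth structure of the total
  space are those determined by the trivializations.
\<close>

record ('m, 'e, 'f) vbundle =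
  fib :: "'m \<Rightarrow> 'e set"
  triv :: "('m set \<times> ('m \<Rightarrow> 'e \<Rightarrow> 'f)) set"

definition triv_inv :: "('m, 'e, 'f) vbundle \<Rightarrow> ('m \<Rightarrow> 'e \<Rightarrow> 'f) \<Rightarrow> 'm \<Rightarrow> 'f \<Rightarrow> 'e"
  where "triv_inv B \<Phi> x = inv_into (fib B x) (\<Phi> x)"

text \<open>
  As \<open>'f\<close> is finite-dimensional, a family of linear maps between typical fibres is smooth iff its
  value at each fixed vector \<open>w\<close> is.
\<close>

definition vector_bundle ::
  "('m::topological_space, 'c::real_normed_vector) chart set \<Rightarrow>
    ('m, 'e::real_vector, 'f::finite_dim_normed_vector) vbundle \<Rightarrow> bool"
  where "vector_bundle A B \<longleftrightarrow>
    (\<forall>x. subspace (fib B x)) \<and>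
    (\<Union>\<tau>\<in>triv B. fst \<tau>) = UNIV \<and>
    (\<forall>(U, \<Phi>)\<in>triv B. open U \<and>
      (\<forall>x\<in>U. linear_map_on (fib B x) UNIV (\<Phi> x) \<and> bij_betw (\<Phi> x) (fib B x) UNIV)) \<and>
    (\<forall>(U, \<Phi>)\<in>triv B. \<forall>(V, \<Psi>)\<in>triv B. \<forall>w.
      smooth_map_on A (U \<inter> V) (\<lambda>x. \<Psi> x (triv_inv B \<Phi> x w)))"

definition sections ::
  "('m, 'c::real_normed_vector) chart set \<Rightarrow>
    ('m, 'e::real_vector, 'f::real_normed_vector) vbundle \<Rightarrow> ('m \<Rightarrow> 'e) set"
  where "sections A B = {s. (\<forall>x. s x \<in> fib B x) \<and>
    (\<forall>(U, \<Phi>)\<in>triv B. smooth_map_on A U (\<lambda>x. \<Phi> x (s x)))}"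

definition nonvanishing :: "('m \<Rightarrow> 'e::zero) \<Rightarrow> bool"
  where "nonvanishing s \<longleftrightarrow> (\<forall>x. s x \<noteq> 0)"

definition fmult :: "('m \<Rightarrow> real) \<Rightarrow> ('m \<Rightarrow> 'e::real_vector) \<Rightarrow> 'm \<Rightarrow> 'e"  (infixr \<open>\<odot>\<close> 75)
  where "f \<odot> s = (\<lambda>x. f x *\<^sub>R s x)"

definition vb_morphism ::
  "('m, 'c::real_normed_vector) chart set \<Rightarrow>
    ('m, 'e::real_vector, 'f::real_normed_vector) vbundle \<Rightarrow>
    ('m, 'g::real_vector, 'h::real_normed_vector) vbundle \<Rightarrow> ('m \<Rightarrow> 'e \<Rightarrow> 'g) \<Rightarrow> bool"
  where "vb_morphism A B B' F \<longleftrightarrow>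
    (\<forall>x. linear_map_on (fib B x) (fib B' x) (F x)) \<and>
    (\<forall>(U, \<Phi>)\<in>triv B. \<forall>(V, \<Psi>)\<in>triv B'. \<forall>w.
      smooth_map_on A (U \<inter> V) (\<lambda>x. \<Psi> x (F x (triv_inv B \<Phi> x w))))"

definition real_bundle :: "('m, real, real) vbundle"
  where "real_bundle = \<lparr>fib = (\<lambda>x. UNIV), triv = {(UNIV, \<lambda>x v. v)}\<rparr>"

definition trivial_line_bundle ::
  "('m::topological_space, 'c::real_normed_vector) chart set \<Rightarrow>
    ('m, 'l::real_vector, real) vbundle \<Rightarrow> bool"
  where "trivial_line_bundle A L \<longleftrightarrow> vector_bundle A L \<and>
    (\<exists>F G. vb_morphism A L real_bundle F \<and> vb_morphism A real_bundle L G \<and>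
      (\<forall>x. (\<forall>v\<in>fib L x. G x (F x v) = v) \<and> (\<forall>t. F x (G x t) = t)))"

text \<open>
  The fibre of \<open>hom_bundle B B'\<close> over \<open>x\<close> consists of the linear maps between the fibres, extended
  by 0 so that each is represented by exactly one HOL function.
\<close>

definition hom_bundle ::
  "('m, 'e::real_vector, 'f::real_normed_vector) vbundle \<Rightarrow>
    ('m, 'g::real_vector, 'h::real_normed_vector) vbundle \<Rightarrow>
    ('m, 'e \<Rightarrow> 'g, 'f \<Rightarrow>\<^sub>L 'h) vbundle"
  where "hom_bundle B B' = \<lparr>
    fib = (\<lambda>x. {T. linear_map_on (fib B x) (fib B' x) T \<and> (\<forall>v. v \<notin> fib B x \<longrightarrow> T v = 0)}),
    triv = {(U \<inter> V, \<lambda>x T. Blinfun (\<lambda>w. \<Psi> x (T (triv_inv B \<Phi> x w)))) | U \<Phi> V \<Psi>.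
      (U, \<Phi>) \<in> triv B \<and> (V, \<Psi>) \<in> triv B'}\<rparr>"

abbreviation end_bundle ::
  "('m, 'e::real_vector, 'f::real_normed_vector) vbundle \<Rightarrow> ('m, 'e \<Rightarrow> 'e, 'f \<Rightarrow>\<^sub>L 'f) vbundle"
  where "end_bundle B \<equiv> hom_bundle B B"

text \<open>The tensor product of finite-dimensional spaces, as the dual of the space of bilinear forms.\<close>

definition bilinear_form_bundle ::
  "('m, 'e::real_vector, 'f::real_normed_vector) vbundle \<Rightarrow>
    ('m, 'g::real_vector, 'h::real_normed_vector) vbundle \<Rightarrow>
    ('m, 'e \<Rightarrow> 'g \<Rightarrow> real, 'f \<Rightarrow>\<^sub>L 'h \<Rightarrow>\<^sub>L real) vbundle"
  where "bilinear_form_bundle B B' = hom_bundle B (hom_bundle B' real_bundle)"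

definition tensor_bundle ::
  "('m, 'e::real_vector, 'f::real_normed_vector) vbundle \<Rightarrow>
    ('m, 'g::real_vector, 'h::real_normed_vector) vbundle \<Rightarrow>
    ('m, ('e, 'g) tensors, ('f \<Rightarrow>\<^sub>L 'h \<Rightarrow>\<^sub>L real) \<Rightarrow>\<^sub>L real) vbundle"
  where "tensor_bundle B B' = hom_bundle (bilinear_form_bundle B B') real_bundle"

definition tensor ::
  "('m, 'e::real_vector, 'f::real_normed_vector) vbundle \<Rightarrow>
    ('m, 'g::real_vector, 'h::real_normed_vector) vbundle \<Rightarrow>
    'm \<Rightarrow> 'e \<Rightarrow> 'g \<Rightarrow> ('e, 'g) tensors"
  where "tensor B B' x u v =
    (\<lambda>\<beta>. if \<beta> \<in> fib (bilinear_form_bundle B B') x then \<beta> u v else 0)"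


section \<open>Tangent and cotangent bundle\<close>

text \<open>
  A tangent vector at \<open>x\<close> assigns to every chart around \<open>x\<close> a vector of the model space, such that
  the values transform by the derivatives of the transition maps; its value at a chart is its
  coordinate vector.
\<close>

definition tangent_space ::
  "('m, 'c::real_normed_vector) chart set \<Rightarrow> 'm \<Rightarrow> ('m, 'c) tvector set"
  where "tangent_space A x = {v.
    (\<forall>\<kappa>\<in>A. \<forall>\<kappa>'\<in>A. x \<in> fst \<kappa> \<inter> fst \<kappa>' \<longrightarrow>
      v \<kappa>' = frechet_derivative (snd \<kappa>' \<circ> chart_inv \<kappa>) (at (snd \<kappa> x)) (v \<kappa>)) \<and>
    (\<forall>\<kappa>. \<not> (\<kappa> \<in> A \<and> x \<in> fst \<kappa>) \<longrightarrow> v \<kappa> = 0)}"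

definition tangent_bundle ::
  "('m, 'c::real_normed_vector) chart set \<Rightarrow> ('m, ('m, 'c) tvector, 'c) vbundle"
  where "tangent_bundle A = \<lparr>
    fib = tangent_space A,
    triv = (\<lambda>\<kappa>. (fst \<kappa>, \<lambda>x v. v \<kappa>)) ` A\<rparr>"

definition cotangent_bundle ::
  "('m, 'c::real_normed_vector) chart set \<Rightarrow>
    ('m, ('m, 'c) covector, 'c \<Rightarrow>\<^sub>L real) vbundle"
  where "cotangent_bundle A = hom_bundle (tangent_bundle A) real_bundle"

definition chart_at :: "('m, 'c) chart set \<Rightarrow> 'm \<Rightarrow> ('m, 'c) chart"
  where "chart_at A x = (SOME \<kappa>. \<kappa> \<in> A \<and> x \<in> fst \<kappa>)"

text \<open>By the chain rule the value does not depend on the chart.\<close>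

definition differential ::
  "('m, 'c::real_normed_vector) chart set \<Rightarrow> ('m \<Rightarrow> real) \<Rightarrow> 'm \<Rightarrow> ('m, 'c) tvector \<Rightarrow> real"
  where "differential A f x = (\<lambda>v. if v \<in> tangent_space A x
    then frechet_derivative (f \<circ> chart_inv (chart_at A x)) (at (snd (chart_at A x) x))
      (v (chart_at A x))
    else 0)"

text \<open>\<open>anchor_deriv A \<rho> e f\<close> is the function \<open>\<rho>(e)(f)\<close>.\<close>

definition anchor_deriv ::
  "('m, 'c::real_normed_vector) chart set \<Rightarrow> ('m \<Rightarrow> 'e \<Rightarrow> ('m, 'c) tvector) \<Rightarrow>
    ('m \<Rightarrow> 'e) \<Rightarrow> ('m \<Rightarrow> real) \<Rightarrow> 'm \<Rightarrow> real"
  where "anchor_deriv A \<rho> e f = (\<lambda>x. differential A f x (\<rho> x (e x)))"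

text \<open>
  The section \<open>\<sigma>(df \<otimes> e)(b)\<close>, for a bundle map \<open>\<sigma>\<close> from the tensor product of the cotangent bundle
  with \<open>E\<close> to an endomorphism bundle.
\<close>

definition symbol_apply ::
  "('m, 'c::real_normed_vector) chart set \<Rightarrow>
    ('m, 'e::real_vector, 'f::real_normed_vector) vbundle \<Rightarrow>
    ('m \<Rightarrow> (('m, 'c) covector, 'e) tensors \<Rightarrow> 'b \<Rightarrow> 'b) \<Rightarrow>
    ('m \<Rightarrow> real) \<Rightarrow> ('m \<Rightarrow> 'e) \<Rightarrow> ('m \<Rightarrow> 'b) \<Rightarrow> 'm \<Rightarrow> 'b"
  where "symbol_apply A E \<sigma> f e b =
    (\<lambda>x. \<sigma> x (tensor (cotangent_bundle A) E x (differential A f x) (e x)) (b x))"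


section \<open>Loday algebroids and nonlinear connections\<close>

definition loday_algebroid ::
  "('m::{t2_space, second_countable_topology}, 'c::finite_dim_normed_vector) chart set \<Rightarrow>
    ('m, 'e::real_vector, 'f::finite_dim_normed_vector) vbundle \<Rightarrow>
    (('m \<Rightarrow> 'e) \<Rightarrow> ('m \<Rightarrow> 'e) \<Rightarrow> 'm \<Rightarrow> 'e) \<Rightarrow>
    ('m \<Rightarrow> 'e \<Rightarrow> ('m, 'c) tvector) \<Rightarrow>
    ('m \<Rightarrow> (('m, 'c) covector, 'e) tensors \<Rightarrow> 'e \<Rightarrow> 'e) \<Rightarrow> bool"
  where "loday_algebroid A E br \<rho> \<alpha> \<longleftrightarrow>
    vector_bundle A E \<and>
    bilinear_map_on (sections A E) (sections A E) (sections A E) br \<and>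
    (\<forall>e1\<in>sections A E. \<forall>e2\<in>sections A E. \<forall>e3\<in>sections A E.
      br e1 (br e2 e3) = br (br e1 e2) e3 + br e2 (br e1 e3)) \<and>
    vb_morphism A E (tangent_bundle A) \<rho> \<and>
    vb_morphism A (tensor_bundle (cotangent_bundle A) E) (end_bundle E) \<alpha> \<and>
    (\<forall>f\<in>smooth_functions A. \<forall>e1\<in>sections A E. \<forall>e2\<in>sections A E.
      br e1 (f \<odot> e2) = f \<odot> br e1 e2 + anchor_deriv A \<rho> e1 f \<odot> e2 \<and>
      br (f \<odot> e1) e2 =
        f \<odot> br e1 e2 - anchor_deriv A \<rho> e2 f \<odot> e1 + symbol_apply A E \<alpha> f e1 e2)"

definition nonlinear_connection ::
  "('m::topological_space, 'c::real_normed_vector) chart set \<Rightarrow>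
    ('m, 'e::real_vector, 'f::real_normed_vector) vbundle \<Rightarrow>
    ('m \<Rightarrow> 'e \<Rightarrow> ('m, 'c) tvector) \<Rightarrow>
    ('m, 'b::real_vector, 'g::real_normed_vector) vbundle \<Rightarrow>
    (('m \<Rightarrow> 'e) \<Rightarrow> ('m \<Rightarrow> 'b) \<Rightarrow> 'm \<Rightarrow> 'b) \<Rightarrow> bool"
  where "nonlinear_connection A E \<rho> B nabla \<longleftrightarrow>
    bilinear_map_on (sections A E) (sections A B) (sections A B) nabla \<and>
    (\<forall>f\<in>smooth_functions A. \<forall>e\<in>sections A E. \<forall>b\<in>sections A B.
      nabla e (f \<odot> b) = f \<odot> nabla e b + anchor_deriv A \<rho> e f \<odot> b) \<and>
    (\<exists>\<sigma>. vb_morphism A (tensor_bundle (cotangent_bundle A) E) (end_bundle B) \<sigma> \<and>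
      (\<forall>f\<in>smooth_functions A. \<forall>e\<in>sections A E. \<forall>b\<in>sections A B.
        nabla (f \<odot> e) b = f \<odot> nabla e b + symbol_apply A E \<sigma> f e b))"

definition curvature ::
  "(('m \<Rightarrow> 'e) \<Rightarrow> ('m \<Rightarrow> 'e) \<Rightarrow> 'm \<Rightarrow> 'e) \<Rightarrow>
    (('m \<Rightarrow> 'e) \<Rightarrow> ('m \<Rightarrow> 'b) \<Rightarrow> 'm \<Rightarrow> 'b::real_vector) \<Rightarrow>
    ('m \<Rightarrow> 'e) \<Rightarrow> ('m \<Rightarrow> 'e) \<Rightarrow> ('m \<Rightarrow> 'b) \<Rightarrow> 'm \<Rightarrow> 'b"
  where "curvature br nabla e1 e2 b =
    nabla e1 (nabla e2 b) - nabla e2 (nabla e1 b) - nabla (br e1 e2) b"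

definition representation ::
  "('m, 'c::real_normed_vector) chart set \<Rightarrow>
    ('m, 'e::real_vector, 'f::real_normed_vector) vbundle \<Rightarrow>
    (('m \<Rightarrow> 'e) \<Rightarrow> ('m \<Rightarrow> 'e) \<Rightarrow> 'm \<Rightarrow> 'e) \<Rightarrow>
    ('m, 'b::real_vector, 'g::real_normed_vector) vbundle \<Rightarrow>
    (('m \<Rightarrow> 'e) \<Rightarrow> ('m \<Rightarrow> 'b) \<Rightarrow> 'm \<Rightarrow> 'b) \<Rightarrow> bool"
  where "representation A E br B nabla \<longleftrightarrow>
    (\<forall>e1\<in>sections A E. \<forall>e2\<in>sections A E. \<forall>b\<in>sections A B. curvature br nabla e1 e2 b = 0)"


section \<open>Cochains of multidifferential operators\<close>

text \<open>
  Order at most \<open>k\<close> in the algebraic sense: iterated commutators with multiplications by \<open>k + 1\<close>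
  functions vanish.
\<close>

primrec diff_op_order ::
  "('m, 'c::real_normed_vector) chart set \<Rightarrow>
    ('m, 'e::real_vector, 'f::real_normed_vector) vbundle \<Rightarrow>
    nat \<Rightarrow> (('m \<Rightarrow> 'e) \<Rightarrow> 'm \<Rightarrow> real) \<Rightarrow> bool"
  where
    "diff_op_order A E 0 P \<longleftrightarrow>
      (\<forall>f\<in>smooth_functions A. \<forall>e\<in>sections A E. P (f \<odot> e) = f * P e)"
  | "diff_op_order A E (Suc k) P \<longleftrightarrow>
      (\<forall>f\<in>smooth_functions A. diff_op_order A E k (\<lambda>e. P (f \<odot> e) - f * P e))"

definition diff_op ::
  "('m, 'c::real_normed_vector) chart set \<Rightarrow>
    ('m, 'e::real_vector, 'f::real_normed_vector) vbundle \<Rightarrow>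
    (('m \<Rightarrow> 'e) \<Rightarrow> 'm \<Rightarrow> real) \<Rightarrow> bool"
  where "diff_op A E P \<longleftrightarrow>
    linear_map_on (sections A E) (smooth_functions A) P \<and> (\<exists>k. diff_op_order A E k P)"

text \<open>
  A \<open>p\<close>-cochain is a function on lists of \<open>p\<close> sections, extended by 0 to all other lists.  Thus
  \<open>cochains A E 0\<close> is the space of smooth functions, embedded by \<open>cochain0\<close>.
\<close>

definition cochains ::
  "('m, 'c::real_normed_vector) chart set \<Rightarrow>
    ('m, 'e::real_vector, 'f::real_normed_vector) vbundle \<Rightarrow>
    nat \<Rightarrow> (('m \<Rightarrow> 'e) list \<Rightarrow> 'm \<Rightarrow> real) set"
  where "cochains A E p = {D.
    (\<forall>es. length es = p \<and> set es \<subseteq> sections A E \<longrightarrow>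
      D es \<in> smooth_functions A \<and> (\<forall>i<p. diff_op A E (\<lambda>e. D (es[i := e])))) \<and>
    (\<forall>es. \<not> (length es = p \<and> set es \<subseteq> sections A E) \<longrightarrow> D es = 0)}"

definition cochain0 :: "('m \<Rightarrow> real) \<Rightarrow> ('m \<Rightarrow> 'e) list \<Rightarrow> 'm \<Rightarrow> real"
  where "cochain0 f es = (if es = [] then f else 0)"

definition delete_nth :: "nat \<Rightarrow> 'a list \<Rightarrow> 'a list"
  where "delete_nth i xs = take i xs @ drop (Suc i) xs"

text \<open>Positions are counted from 0, which shifts the exponents of the signs by one.\<close>

definition coboundary ::
  "('m, 'c::real_normed_vector) chart set \<Rightarrow>
    ('m, 'e::real_vector, 'f::real_normed_vector) vbundle \<Rightarrow>
    (('m \<Rightarrow> 'e) \<Rightarrow> ('m \<Rightarrow> 'e) \<Rightarrow> 'm \<Rightarrow> 'e) \<Rightarrow>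
    ('m \<Rightarrow> 'e \<Rightarrow> ('m, 'c) tvector) \<Rightarrow>
    (('m \<Rightarrow> 'e) list \<Rightarrow> 'm \<Rightarrow> real) \<Rightarrow> ('m \<Rightarrow> 'e) list \<Rightarrow> 'm \<Rightarrow> real"
  where "coboundary A E br \<rho> D es = (\<lambda>x.
    if set es \<subseteq> sections A E then
      (\<Sum>i<length es. (-1) ^ i * anchor_deriv A \<rho> (es ! i) (D (delete_nth i es)) x) +
      (\<Sum>j<length es. \<Sum>i<j.
        (-1) ^ Suc i * D (delete_nth i (es[j := br (es ! i) (es ! j)])) x)
    else 0)"

definition cocycles ::
  "('m, 'c::real_normed_vector) chart set \<Rightarrow>
    ('m, 'e::real_vector, 'f::real_normed_vector) vbundle \<Rightarrow>
    (('m \<Rightarrow> 'e) \<Rightarrow> ('m \<Rightarrow> 'e) \<Rightarrow> 'm \<Rightarrow> 'e) \<Rightarrow>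
    ('m \<Rightarrow> 'e \<Rightarrow> ('m, 'c) tvector) \<Rightarrow>
    nat \<Rightarrow> (('m \<Rightarrow> 'e) list \<Rightarrow> 'm \<Rightarrow> real) set"
  where "cocycles A E br \<rho> p = {D \<in> cochains A E p. coboundary A E br \<rho> D = 0}"

definition coboundaries ::
  "('m, 'c::real_normed_vector) chart set \<Rightarrow>
    ('m, 'e::real_vector, 'f::real_normed_vector) vbundle \<Rightarrow>
    (('m \<Rightarrow> 'e) \<Rightarrow> ('m \<Rightarrow> 'e) \<Rightarrow> 'm \<Rightarrow> 'e) \<Rightarrow>
    ('m \<Rightarrow> 'e \<Rightarrow> ('m, 'c) tvector) \<Rightarrow>
    nat \<Rightarrow> (('m \<Rightarrow> 'e) list \<Rightarrow> 'm \<Rightarrow> real) set"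
  where "coboundaries A E br \<rho> p =
    (case p of 0 \<Rightarrow> {0} | Suc q \<Rightarrow> coboundary A E br \<rho> ` cochains A E q)"

definition cohomologous ::
  "('m, 'c::real_normed_vector) chart set \<Rightarrow>
    ('m, 'e::real_vector, 'f::real_normed_vector) vbundle \<Rightarrow>
    (('m \<Rightarrow> 'e) \<Rightarrow> ('m \<Rightarrow> 'e) \<Rightarrow> 'm \<Rightarrow> 'e) \<Rightarrow>
    ('m \<Rightarrow> 'e \<Rightarrow> ('m, 'c) tvector) \<Rightarrow>
    nat \<Rightarrow> ((('m \<Rightarrow> 'e) list \<Rightarrow> 'm \<Rightarrow> real) \<times> (('m \<Rightarrow> 'e) list \<Rightarrow> 'm \<Rightarrow> real)) set"
  where "cohomologous A E br \<rho> p = {(D, D').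
    D \<in> cocycles A E br \<rho> p \<and> D' \<in> cocycles A E br \<rho> p \<and> D - D' \<in> coboundaries A E br \<rho> p}"

definition cohomology ::
  "('m, 'c::real_normed_vector) chart set \<Rightarrow>
    ('m, 'e::real_vector, 'f::real_normed_vector) vbundle \<Rightarrow>
    (('m \<Rightarrow> 'e) \<Rightarrow> ('m \<Rightarrow> 'e) \<Rightarrow> 'm \<Rightarrow> 'e) \<Rightarrow>
    ('m \<Rightarrow> 'e \<Rightarrow> ('m, 'c) tvector) \<Rightarrow>
    nat \<Rightarrow> (('m \<Rightarrow> 'e) list \<Rightarrow> 'm \<Rightarrow> real) set set"
  where "cohomology A E br \<rho> p = cocycles A E br \<rho> p // cohomologous A E br \<rho> p"

definition cohomology_class ::
  "('m, 'c::real_normed_vector) chart set \<Rightarrow>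
    ('m, 'e::real_vector, 'f::real_normed_vector) vbundle \<Rightarrow>
    (('m \<Rightarrow> 'e) \<Rightarrow> ('m \<Rightarrow> 'e) \<Rightarrow> 'm \<Rightarrow> 'e) \<Rightarrow>
    ('m \<Rightarrow> 'e \<Rightarrow> ('m, 'c) tvector) \<Rightarrow>
    nat \<Rightarrow> (('m \<Rightarrow> 'e) list \<Rightarrow> 'm \<Rightarrow> real) \<Rightarrow> (('m \<Rightarrow> 'e) list \<Rightarrow> 'm \<Rightarrow> real) set"
  where "cohomology_class A E br \<rho> p D = cohomologous A E br \<rho> p `` {D}"

text \<open>The cochain \<open>\<theta>\<^sub>s\<close> of a connection on a line bundle, for a nonvanishing section \<open>s\<close>.\<close>

definition connection_op ::
  "('m, 'c::real_normed_vector) chart set \<Rightarrow>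
    ('m, 'e::real_vector, 'f::real_normed_vector) vbundle \<Rightarrow>
    (('m \<Rightarrow> 'e) \<Rightarrow> ('m \<Rightarrow> 'l::real_vector) \<Rightarrow> 'm \<Rightarrow> 'l) \<Rightarrow>
    ('m \<Rightarrow> 'l) \<Rightarrow> ('m \<Rightarrow> 'e) list \<Rightarrow> 'm \<Rightarrow> real"
  where "connection_op A E nabla s es =
    (if length es = 1 \<and> set es \<subseteq> sections A E
     then (THE f. nabla (hd es) s = f \<odot> s)
     else 0)"

end

theory Submission
  imports Defs
begin

text \<open>
  Sections of a line bundle with a nonvanishing section \<open>s\<close> are the multiples \<open>f \<odot> s\<close> with \<open>f\<close> smooth
  (\<open>section_quotient_smooth\<close>), so a connection is determined by \<open>\<theta>\<close>, where \<open>\<nabla>\<^sub>e s = \<theta>(e) \<odot> s\<close>, through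
  the Leibniz rule \<open>\<nabla>\<^sub>e(h \<odot> s) = (h \<theta>(e) + \<rho>(e)(h)) \<odot> s\<close>.  Everything follows from this formula.

  For the curvature, apply the formula twice.  On \<open>s\<close> itself the products of values of \<open>\<theta>\<close> cancel,
  and \<open>\<rho>(e1)(\<theta>(e2)) - \<rho>(e2)(\<theta>(e1)) - \<theta>([e1,e2])\<close> is left, which is the coboundary of \<open>\<theta>\<close>.  On a
  general section the curvature is the same multiple because the anchor maps brackets to
  commutators (\<open>anchor_deriv_bracket\<close>), a consequence of the Loday identity and the Leibniz rule for
  the bracket.  Hence the curvature vanishes iff \<open>\<theta>\<close> is a cocycle.  That \<open>\<theta>\<close> is a cochain, a
  differential operator of order at most 1, is the condition on \<open>\<nabla>\<^bsub>fe\<^esub>\<close> (\<open>\<theta>_diff_op\<close>).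

  For another nonvanishing section \<open>f \<odot> s\<close>, the formula with \<open>h = f\<close> shows that \<open>\<theta>\<close> changes by
  \<open>\<rho>(e)(f) / f = \<rho>(e)(ln \<bar>f\<bar>)\<close>, the coboundary of \<open>ln \<bar>f\<bar>\<close> (\<open>connection_op_change_section\<close>).  The
  classes agree as being cohomologous is an equivalence relation on 1-cocycles.

  Additivity, the product rule and the derivative of \<open>ln \<bar>f\<bar>\<close> for the derivations \<open>\<rho>(e)\<close> are computed in
  charts; this is what the calculus at the beginning provides.
\<close>

section \<open>Calculus of smooth functions on open sets\<close>

lemma Ck_on_cong:
  assumes "open S" "\<And>x. x \<in> S \<Longrightarrow> f x = g x" "Ck_on k S f"
  shows "Ck_on k S g"
  using assms(2,3)
proof (induction k arbitrary: f g)
  case 0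
  then show ?case by (auto cong: continuous_on_cong)
next
  case (Suc k)
  have *: "(g has_derivative frechet_derivative f (at x)) (at x)" if "x \<in> S" for x
  proof -
    have "(f has_derivative frechet_derivative f (at x)) (at x)"
      using Suc.prems(2) that by (simp add: frechet_derivative_works)
    then show ?thesis
      using has_derivative_transform_within_open[OF _ assms(1) that] Suc.prems(1) by blast
  qed
  have "Ck_on k S (\<lambda>x. frechet_derivative g (at x) v)" for v
  proof (rule Suc.IH)
    show "Ck_on k S (\<lambda>x. frechet_derivative f (at x) v)"
      using Suc.prems(2) by simp
    show "frechet_derivative f (at x) v = frechet_derivative g (at x) v" if "x \<in> S" for x
      using frechet_derivative_at[OF *[OF that]] by simp
  qed
  moreover have "g differentiable (at x)" if "x \<in> S" for x
    using *[OF that] differentiable_def by blast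
  ultimately show ?case by simp
qed

lemma Ck_on_SucI:
  assumes "open S"
    and "\<And>x. x \<in> S \<Longrightarrow> (f has_derivative f' x) (at x)"
    and "\<And>v. Ck_on k S (\<lambda>x. f' x v)"
  shows "Ck_on (Suc k) S f"
proof -
  have "Ck_on k S (\<lambda>x. frechet_derivative f (at x) v)" for v
  proof (rule Ck_on_cong[OF assms(1)])
    show "Ck_on k S (\<lambda>x. f' x v)"
      by (rule assms(3))
    show "f' x v = frechet_derivative f (at x) v" if "x \<in> S" for x
      using frechet_derivative_at[OF assms(2)[OF that]] by simp
  qed
  then show ?thesis
    using assms(2) by (auto simp: differentiable_def)
qed

lemma Ck_on_Suc_has_derivative:
  assumes "Ck_on (Suc k) S f" "x \<in> S"
  shows "(f has_derivative frechet_derivative f (at x)) (at x)"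
  using assms by (simp add: frechet_derivative_works)

lemma Ck_on_Suc_lower: "Ck_on (Suc k) S f \<Longrightarrow> Ck_on k S f"
proof (induction k arbitrary: f)
  case 0
  then show ?case
    by (auto intro!: continuous_at_imp_continuous_on differentiable_imp_continuous_within)
next
  case (Suc k)
  then show ?case by simp
qed

lemma Ck_on_subset: "Ck_on k S f \<Longrightarrow> T \<subseteq> S \<Longrightarrow> Ck_on k T f"
  by (induction k arbitrary: f) (auto intro: continuous_on_subset)

lemma Ck_on_local:
  assumes "\<And>x. x \<in> S \<Longrightarrow> \<exists>T. open T \<and> x \<in> T \<and> Ck_on k T f"
  shows "Ck_on k S f"
  using assms
proof (induction k arbitrary: f)
  case 0
  have "continuous (at x) f" if "x \<in> S" for x
    using 0[OF that] by (auto simp: continuous_on_eq_continuous_at)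
  then show ?case
    by (simp add: continuous_at_imp_continuous_on)
next
  case (Suc k)
  have "f differentiable (at x)" if "x \<in> S" for x
    using Suc.prems[OF that] by auto
  moreover have "Ck_on k S (\<lambda>x. frechet_derivative f (at x) v)" for v
    by (rule Suc.IH) (use Suc.prems in fastforce)
  ultimately show ?case by simp
qed

lemma Ck_on_const: "open S \<Longrightarrow> Ck_on k S (\<lambda>x. c)"
proof (induction k arbitrary: c)
  case (Suc k)
  show ?case
    by (rule Ck_on_SucI[where f' = "\<lambda>x v. 0"]) (use Suc in simp_all)
qed simp

lemma Ck_on_add:
  assumes "open S" "Ck_on k S f" "Ck_on k S g"
  shows "Ck_on k S (\<lambda>x. f x + g x)"
  using assms(2,3)
proof (induction k arbitrary: f g)
  case 0
  then show ?case by (simp add: continuous_on_add)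
next
  case (Suc k)
  show ?case
  proof (rule Ck_on_SucI[OF assms(1)])
    show "((\<lambda>x. f x + g x) has_derivative
        (\<lambda>v. frechet_derivative f (at x) v + frechet_derivative g (at x) v)) (at x)"
      if "x \<in> S" for x
      by (intro has_derivative_add Ck_on_Suc_has_derivative[OF Suc.prems(1) that]
            Ck_on_Suc_has_derivative[OF Suc.prems(2) that])
    show "Ck_on k S (\<lambda>x. frechet_derivative f (at x) v + frechet_derivative g (at x) v)" for v
      by (rule Suc.IH) (use Suc.prems in simp_all)
  qed
qed

lemma Ck_on_scaleR:
  fixes f :: "'a::real_normed_vector \<Rightarrow> real" and g :: "'a \<Rightarrow> 'b::real_normed_vector"
  assumes "open S" "Ck_on k S f" "Ck_on k S g"
  shows "Ck_on k S (\<lambda>x. f x *\<^sub>R g x)"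
  using assms(2,3)
proof (induction k arbitrary: f g)
  case 0
  then show ?case by (simp add: continuous_on_scaleR)
next
  case (Suc k)
  show ?case
  proof (rule Ck_on_SucI[OF assms(1)])
    show "((\<lambda>x. f x *\<^sub>R g x) has_derivative
        (\<lambda>v. f x *\<^sub>R frechet_derivative g (at x) v + frechet_derivative f (at x) v *\<^sub>R g x)) (at x)"
      if "x \<in> S" for x
      by (intro has_derivative_scaleR Ck_on_Suc_has_derivative[OF Suc.prems(1) that]
            Ck_on_Suc_has_derivative[OF Suc.prems(2) that])
    show "Ck_on k S
        (\<lambda>x. f x *\<^sub>R frechet_derivative g (at x) v + frechet_derivative f (at x) v *\<^sub>R g x)" for v
      by (intro Ck_on_add[OF assms(1)] Suc.IH Ck_on_Suc_lower[OF Suc.prems(1)]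
            Ck_on_Suc_lower[OF Suc.prems(2)])
         (use Suc.prems in simp_all)
  qed
qed

lemma Ck_on_inverse:
  fixes f :: "'a::real_normed_vector \<Rightarrow> real"
  assumes "open S" "\<And>x. x \<in> S \<Longrightarrow> f x \<noteq> 0" "Ck_on k S f"
  shows "Ck_on k S (\<lambda>x. inverse (f x))"
  using assms(3)
proof (induction k)
  case 0
  then show ?case using assms(2) by (simp add: continuous_on_inverse)
next
  case (Suc k)
  have IH: "Ck_on k S (\<lambda>x. inverse (f x))"
    using Suc.IH Ck_on_Suc_lower[OF Suc.prems] .
  show ?case
  proof (rule Ck_on_SucI[OF assms(1)])
    (* The derivative is written with scalar products so that it is covered by Ck_on_scaleR. *)
    show "((\<lambda>x. inverse (f x)) has_derivative
        (\<lambda>v. (- 1) *\<^sub>R (inverse (f x) *\<^sub>R (frechet_derivative f (at x) v *\<^sub>R inverse (f x)))))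
        (at x)" if "x \<in> S" for x
      using Deriv.has_derivative_inverse[OF assms(2)[OF that] Ck_on_Suc_has_derivative[OF Suc.prems that]]
      by (simp add: mult.assoc)
    show "Ck_on k S (\<lambda>x.
        (- 1) *\<^sub>R (inverse (f x) *\<^sub>R (frechet_derivative f (at x) v *\<^sub>R inverse (f x))))" for v
      by (intro Ck_on_scaleR Ck_on_const IH assms(1)) (use Suc.prems in simp)
  qed
qed

lemma has_derivative_ln_abs:
  fixes f :: "'a::real_normed_vector \<Rightarrow> real"
  assumes "(f has_derivative f') (at x)" "f x \<noteq> 0"
  shows "((\<lambda>y. ln \<bar>f y\<bar>) has_derivative (\<lambda>v. inverse (f x) * f' v)) (at x)"
proof -
  have "((\<lambda>t. ln \<bar>t\<bar>) has_real_derivative inverse t) (at t)" if "t \<noteq> 0" for t :: real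
  proof (cases "t > 0")
    case True
    show ?thesis
      by (rule has_field_derivative_transform_within_open[OF DERIV_ln[OF True], of "{0<..}"])
         (use True in auto)
  next
    case False
    have "((\<lambda>t. ln (- t)) has_real_derivative inverse t) (at t)"
      using that False by (auto intro!: derivative_eq_intros simp: field_simps)
    then show ?thesis
      by (rule has_field_derivative_transform_within_open[where S = "{..<0}"])
         (use that False in auto)
  qed
  from has_derivative_compose[OF assms(1) this[OF assms(2), unfolded has_field_derivative_def]]
  show ?thesis by simp
qed

lemma Ck_on_ln_abs:
  fixes f :: "'a::real_normed_vector \<Rightarrow> real"
  assumes "open S" "\<And>x. x \<in> S \<Longrightarrow> f x \<noteq> 0" "Ck_on k S f"
  shows "Ck_on k S (\<lambda>x. ln \<bar>f x\<bar>)"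
proof (cases k)
  case 0
  then show ?thesis using assms(2,3) by (auto intro!: continuous_intros)
next
  case (Suc k')
  note f = assms(3)[unfolded Suc]
  show ?thesis
    unfolding Suc
  proof (rule Ck_on_SucI[OF assms(1)])
    show "((\<lambda>x. ln \<bar>f x\<bar>) has_derivative
        (\<lambda>v. inverse (f x) *\<^sub>R frechet_derivative f (at x) v)) (at x)" if "x \<in> S" for x
      using has_derivative_ln_abs[OF Ck_on_Suc_has_derivative[OF f that] assms(2)[OF that]] by simp
    show "Ck_on k' S (\<lambda>x. inverse (f x) *\<^sub>R frechet_derivative f (at x) v)" for v
      by (intro Ck_on_scaleR Ck_on_inverse assms(1,2) Ck_on_Suc_lower[OF f]) (use f in simp_all)
  qed
qed


section \<open>Smooth functions on a manifold\<close>

lemma chart_inv_chart: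
  assumes "smooth_manifold A" "\<kappa> \<in> A" "x \<in> fst \<kappa>"
  shows "chart_inv \<kappa> (snd \<kappa> x) = x"
  using assms unfolding smooth_manifold_def homeomorphism_def by blast

lemma open_chart_image:
  assumes "smooth_manifold A" "\<kappa> \<in> A" "open U"
  shows "open (snd \<kappa> ` (U \<inter> fst \<kappa>))"
proof -
  have op: "open (fst \<kappa>)" "open (snd \<kappa> ` fst \<kappa>)"
    and hom: "homeomorphism (fst \<kappa>) (snd \<kappa> ` fst \<kappa>) (snd \<kappa>) (chart_inv \<kappa>)"
    using assms unfolding smooth_manifold_def by blast+
  have "openin (top_of_set (fst \<kappa>)) (U \<inter> fst \<kappa>)"
    using assms(3) by (metis Int_commute openin_open_Int)
  then have "openin (top_of_set (snd \<kappa> ` fst \<kappa>)) (snd \<kappa> ` (U \<inter> fst \<kappa>))"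
    by (rule homeomorphism_imp_open_map[OF hom])
  then show ?thesis
    using op(2) openin_open_eq by blast
qed

lemma chart_at:
  assumes "smooth_manifold A"
  shows "chart_at A x \<in> A" "x \<in> fst (chart_at A x)"
proof -
  have "\<exists>\<kappa>. \<kappa> \<in> A \<and> x \<in> fst \<kappa>"
    using assms unfolding smooth_manifold_def by blast
  from someI_ex[OF this] show "chart_at A x \<in> A" "x \<in> fst (chart_at A x)"
    unfolding chart_at_def by auto
qed

text \<open>
  This transfers the closure properties of functions on open sets of the model space to smooth
  maps: in a chart, only the values of \<open>h\<close> along the inverse of that chart matter.
\<close>

lemma smooth_map_onI:
  assumes "smooth_manifold A" "open U"
    and "\<And>\<kappa> k. \<kappa> \<in> A \<Longrightarrow> open (snd \<kappa> ` (U \<inter> fst \<kappa>)) \<Longrightarrow>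
      (\<And>y. y \<in> snd \<kappa> ` (U \<inter> fst \<kappa>) \<Longrightarrow> chart_inv \<kappa> y \<in> U) \<Longrightarrow>
      Ck_on k (snd \<kappa> ` (U \<inter> fst \<kappa>)) (\<lambda>y. h (chart_inv \<kappa> y))"
  shows "smooth_map_on A U h"
proof -
  have "Ck_on k (snd \<kappa> ` (U \<inter> fst \<kappa>)) (\<lambda>y. h (chart_inv \<kappa> y))" if "\<kappa> \<in> A" for \<kappa> k
  proof (rule assms(3)[OF that])
    show "open (snd \<kappa> ` (U \<inter> fst \<kappa>))"
      by (rule open_chart_image[OF assms(1) that assms(2)])
    show "chart_inv \<kappa> y \<in> U" if "y \<in> snd \<kappa> ` (U \<inter> fst \<kappa>)" for y
      using that chart_inv_chart[OF assms(1) \<open>\<kappa> \<in> A\<close>] by auto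
  qed
  then show ?thesis
    unfolding smooth_map_on_def smooth_on_def by (simp add: o_def)
qed

lemma smooth_map_onD:
  "smooth_map_on A U f \<Longrightarrow> \<kappa> \<in> A \<Longrightarrow> Ck_on k (snd \<kappa> ` (U \<inter> fst \<kappa>)) (\<lambda>y. f (chart_inv \<kappa> y))"
  unfolding smooth_map_on_def smooth_on_def by (simp add: o_def)

lemma smooth_map_on_cong:
  assumes "smooth_manifold A" "open U" "smooth_map_on A U f" "\<And>x. x \<in> U \<Longrightarrow> f x = g x"
  shows "smooth_map_on A U g"
proof (rule smooth_map_onI[OF assms(1,2)])
  fix \<kappa> k
  assume k: "\<kappa> \<in> A" "open (snd \<kappa> ` (U \<inter> fst \<kappa>))"
    and inv: "\<And>y. y \<in> snd \<kappa> ` (U \<inter> fst \<kappa>) \<Longrightarrow> chart_inv \<kappa> y \<in> U"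
  show "Ck_on k (snd \<kappa> ` (U \<inter> fst \<kappa>)) (\<lambda>y. g (chart_inv \<kappa> y))"
    by (rule Ck_on_cong[OF k(2) _ smooth_map_onD[OF assms(3) k(1)]]) (simp add: assms(4) inv)
qed

lemma smooth_map_on_subset: "smooth_map_on A U f \<Longrightarrow> V \<subseteq> U \<Longrightarrow> smooth_map_on A V f"
  unfolding smooth_map_on_def smooth_on_def by (meson Ck_on_subset Int_mono image_mono order_refl)

lemma smooth_map_on_local:
  assumes "smooth_manifold A" "\<And>x. \<exists>U. open U \<and> x \<in> U \<and> smooth_map_on A U f"
  shows "smooth_map_on A UNIV f"
proof (rule smooth_map_onI[OF assms(1) open_UNIV])
  fix \<kappa> k
  assume k: "\<kappa> \<in> A"
  show "Ck_on k (snd \<kappa> ` (UNIV \<inter> fst \<kappa>)) (\<lambda>y. f (chart_inv \<kappa> y))"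
  proof (rule Ck_on_local)
    fix y
    assume "y \<in> snd \<kappa> ` (UNIV \<inter> fst \<kappa>)"
    then obtain x where x: "x \<in> fst \<kappa>" "y = snd \<kappa> x"
      by auto
    obtain U where U: "open U" "x \<in> U" "smooth_map_on A U f"
      using assms(2) by blast
    show "\<exists>T. open T \<and> y \<in> T \<and> Ck_on k T (\<lambda>y. f (chart_inv \<kappa> y))"
      using open_chart_image[OF assms(1) k U(1)] smooth_map_onD[OF U(3) k] x U(2) by blast
  qed
qed

lemma smooth_map_on_const: "smooth_manifold A \<Longrightarrow> open U \<Longrightarrow> smooth_map_on A U (\<lambda>x. c)"
  by (rule smooth_map_onI) (auto intro: Ck_on_const)

lemma smooth_map_on_add:
  assumes "smooth_manifold A" "open U" "smooth_map_on A U f" "smooth_map_on A U g"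
  shows "smooth_map_on A U (\<lambda>x. f x + g x)"
  by (rule smooth_map_onI[OF assms(1,2)])
     (intro Ck_on_add smooth_map_onD[OF assms(3)] smooth_map_onD[OF assms(4)])

lemma smooth_map_on_scaleR:
  fixes f :: "'m::{t2_space, second_countable_topology} \<Rightarrow> real"
  assumes "smooth_manifold A" "open U" "smooth_map_on A U f" "smooth_map_on A U g"
  shows "smooth_map_on A U (\<lambda>x. f x *\<^sub>R g x)"
  by (rule smooth_map_onI[OF assms(1,2)])
     (intro Ck_on_scaleR smooth_map_onD[OF assms(3)] smooth_map_onD[OF assms(4)])

lemma smooth_map_on_inverse:
  fixes f :: "'m::{t2_space, second_countable_topology} \<Rightarrow> real"
  assumes "smooth_manifold A" "open U" "smooth_map_on A U f" "\<And>x. x \<in> U \<Longrightarrow> f x \<noteq> 0"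
  shows "smooth_map_on A U (\<lambda>x. inverse (f x))"
  by (rule smooth_map_onI[OF assms(1,2)])
     (intro Ck_on_inverse smooth_map_onD[OF assms(3)] assms(4))

lemma smooth_functions_const: "smooth_manifold A \<Longrightarrow> (\<lambda>x. c) \<in> smooth_functions A"
  by (simp add: smooth_functions_def smooth_map_on_const)

lemma smooth_functions_add:
  "smooth_manifold A \<Longrightarrow> f \<in> smooth_functions A \<Longrightarrow> g \<in> smooth_functions A \<Longrightarrow>
    (\<lambda>x. f x + g x) \<in> smooth_functions A"
  by (simp add: smooth_functions_def smooth_map_on_add)

lemma smooth_functions_mult:
  "smooth_manifold A \<Longrightarrow> f \<in> smooth_functions A \<Longrightarrow> g \<in> smooth_functions A \<Longrightarrow>
    (\<lambda>x. f x * g x) \<in> smooth_functions A"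
  using smooth_map_on_scaleR[of A UNIV f g] by (simp add: smooth_functions_def)

lemma smooth_functions_diff:
  assumes "smooth_manifold A" "f \<in> smooth_functions A" "g \<in> smooth_functions A"
  shows "(\<lambda>x. f x - g x) \<in> smooth_functions A"
  using smooth_functions_add[OF assms(1,2)
      smooth_functions_mult[OF assms(1) smooth_functions_const[OF assms(1), of "- 1"] assms(3)]]
  by simp

lemma smooth_functions_ln_abs:
  assumes "smooth_manifold A" "f \<in> smooth_functions A" "nonvanishing f"
  shows "(\<lambda>x. ln \<bar>f x\<bar>) \<in> smooth_functions A"
proof -
  have "smooth_map_on A UNIV f" "\<And>x. f x \<noteq> 0"
    using assms by (auto simp: smooth_functions_def nonvanishing_def)
  then have "smooth_map_on A UNIV (\<lambda>x. ln \<bar>f x\<bar>)"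
    by (intro smooth_map_onI[OF assms(1) open_UNIV] Ck_on_ln_abs smooth_map_onD)
  then show ?thesis
    by (simp add: smooth_functions_def)
qed


section \<open>Sections of vector bundles\<close>

lemma linear_map_onD:
  assumes "linear_map_on V W L"
  shows "v \<in> V \<Longrightarrow> L v \<in> W"
    and "u \<in> V \<Longrightarrow> v \<in> V \<Longrightarrow> L (u + v) = L u + L v"
    and "v \<in> V \<Longrightarrow> L (c *\<^sub>R v) = c *\<^sub>R L v"
  using assms by (auto simp: linear_map_on_def)

lemma sectionsI:
  assumes "\<And>x. s x \<in> fib B x"
    and "\<And>U \<Phi>. (U, \<Phi>) \<in> triv B \<Longrightarrow> smooth_map_on A U (\<lambda>x. \<Phi> x (s x))"
  shows "s \<in> sections A B"
  using assms by (auto simp: sections_def)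

lemma sectionsD:
  assumes "s \<in> sections A B"
  shows "s x \<in> fib B x"
    and "(U, \<Phi>) \<in> triv B \<Longrightarrow> smooth_map_on A U (\<lambda>x. \<Phi> x (s x))"
  using assms by (auto simp: sections_def)

lemma vector_bundleD:
  assumes "vector_bundle A B"
  shows "subspace (fib B x)"
    and "\<exists>U \<Phi>. (U, \<Phi>) \<in> triv B \<and> x \<in> U"
    and "(U, \<Phi>) \<in> triv B \<Longrightarrow> open U"
    and "(U, \<Phi>) \<in> triv B \<Longrightarrow> x \<in> U \<Longrightarrow> linear_map_on (fib B x) UNIV (\<Phi> x)"
    and "(U, \<Phi>) \<in> triv B \<Longrightarrow> x \<in> U \<Longrightarrow> inj_on (\<Phi> x) (fib B x)"
proof -
  have "x \<in> (\<Union>\<tau>\<in>triv B. fst \<tau>)"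
    using assms unfolding vector_bundle_def by blast
  then show "\<exists>U \<Phi>. (U, \<Phi>) \<in> triv B \<and> x \<in> U"
    by auto
qed (use assms in \<open>auto simp: vector_bundle_def bij_betw_def\<close>)

lemma sections_add:
  assumes "smooth_manifold A" "vector_bundle A B" "s \<in> sections A B" "t \<in> sections A B"
  shows "s + t \<in> sections A B"
proof (rule sectionsI)
  show "(s + t) x \<in> fib B x" for x
    using vector_bundleD(1)[OF assms(2)] sectionsD(1)[OF assms(3)] sectionsD(1)[OF assms(4)]
    by (simp add: subspace_add)
  fix U \<Phi>
  assume T: "(U, \<Phi>) \<in> triv B"
  note U = vector_bundleD(3)[OF assms(2) T]
  show "smooth_map_on A U (\<lambda>x. \<Phi> x ((s + t) x))"
    by (rule smooth_map_on_cong[OF assms(1) U smooth_map_on_add[OF assms(1) U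
          sectionsD(2)[OF assms(3) T] sectionsD(2)[OF assms(4) T]]])
       (simp add: linear_map_onD(2)[OF vector_bundleD(4)[OF assms(2) T]]
          sectionsD(1)[OF assms(3)] sectionsD(1)[OF assms(4)])
qed

lemma sections_fmult:
  assumes "smooth_manifold A" "vector_bundle A B" "f \<in> smooth_functions A" "s \<in> sections A B"
  shows "f \<odot> s \<in> sections A B"
proof (rule sectionsI)
  show "(f \<odot> s) x \<in> fib B x" for x
    using vector_bundleD(1)[OF assms(2)] sectionsD(1)[OF assms(4)]
    by (simp add: fmult_def subspace_scale)
  fix U \<Phi>
  assume T: "(U, \<Phi>) \<in> triv B"
  note U = vector_bundleD(3)[OF assms(2) T]
  have f: "smooth_map_on A U f"
    using assms(3) smooth_map_on_subset unfolding smooth_functions_def by blast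
  show "smooth_map_on A U (\<lambda>x. \<Phi> x ((f \<odot> s) x))"
    by (rule smooth_map_on_cong[OF assms(1) U smooth_map_on_scaleR[OF assms(1) U f
          sectionsD(2)[OF assms(4) T]]])
       (simp add: fmult_def linear_map_onD(3)[OF vector_bundleD(4)[OF assms(2) T]]
          sectionsD(1)[OF assms(4)])
qed

lemma scaleR_section_eq_fmult: "c *\<^sub>R s = (\<lambda>x. c) \<odot> s"
  by (simp add: scaleR_fun_def fmult_def)

lemma sections_scaleR:
  "smooth_manifold A \<Longrightarrow> vector_bundle A B \<Longrightarrow> s \<in> sections A B \<Longrightarrow> c *\<^sub>R s \<in> sections A B"
  by (simp add: scaleR_section_eq_fmult sections_fmult smooth_functions_const)

lemma sections_diff:
  assumes "smooth_manifold A" "vector_bundle A B" "s \<in> sections A B" "t \<in> sections A B"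
  shows "s - t \<in> sections A B"
proof -
  have "s - t = s + (- 1) *\<^sub>R t"
    by (simp add: fun_eq_iff scaleR_fun_def)
  then show ?thesis
    using sections_add[OF assms(1,2,3) sections_scaleR[OF assms(1,2,4), of "- 1"]] by simp
qed

lemma fmult_cancel: "nonvanishing s \<Longrightarrow> f \<odot> s = g \<odot> s \<longleftrightarrow> f = g"
  by (auto simp: nonvanishing_def fmult_def fun_eq_iff)

text \<open>
  The fibres are lines, so the quotient exists pointwise; in a local trivialization it is the
  quotient of the two coordinate functions, which is smooth.
\<close>

lemma section_quotient_smooth:
  fixes L :: "('m::{t2_space, second_countable_topology}, 'l::real_vector, real) vbundle"
  assumes "smooth_manifold A" "vector_bundle A L"
    and s: "s \<in> sections A L" "nonvanishing s" and b: "b \<in> sections A L"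
  shows "\<exists>f\<in>smooth_functions A. b = f \<odot> s"
proof -
  define f where "f x = (THE c. b x = c *\<^sub>R s x)" for x
  have nonzero: "\<Phi> x (s x) \<noteq> 0"
    and quotient: "f x = \<Phi> x (b x) * inverse (\<Phi> x (s x))"
    and multiple: "b x = f x *\<^sub>R s x"
    if T: "(U, \<Phi>) \<in> triv L" "x \<in> U" for U \<Phi> x
  proof -
    note lin = vector_bundleD(4)[OF assms(2) T] and inj = vector_bundleD(5)[OF assms(2) T]
    note sub = vector_bundleD(1)[OF assms(2), of x]
    note sx = sectionsD(1)[OF s(1), of x] and bx = sectionsD(1)[OF b, of x]
    have s0: "s x \<noteq> 0"
      using s(2) by (simp add: nonvanishing_def)
    have "\<Phi> x 0 = 0"
      using linear_map_onD(3)[OF lin sx, of 0] by simp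
    then have nz: "\<Phi> x (s x) \<noteq> 0"
      using inj_onD[OF inj, of "s x" 0] sx subspace_0[OF sub] s0 by auto
    let ?c = "\<Phi> x (b x) * inverse (\<Phi> x (s x))"
    have "\<Phi> x (?c *\<^sub>R s x) = \<Phi> x (b x)"
      using linear_map_onD(3)[OF lin sx, of ?c] nz by simp
    then have bc: "b x = ?c *\<^sub>R s x"
      using inj_onD[OF inj, of "?c *\<^sub>R s x" "b x"] bx subspace_scale[OF sub sx] by simp
    have fx: "f x = ?c"
      unfolding f_def
    proof (rule the_equality, rule bc)
      fix c
      assume "b x = c *\<^sub>R s x"
      from trans[OF this[symmetric] bc] show "c = ?c"
        using s0 by simp
    qed
    have "b x = f x *\<^sub>R s x"
      unfolding fx by (rule bc)
    with nz fx show "\<Phi> x (s x) \<noteq> 0" "f x = ?c" "b x = f x *\<^sub>R s x" .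
  qed
  have "smooth_map_on A UNIV f"
  proof (rule smooth_map_on_local[OF assms(1)])
    fix x
    obtain U \<Phi> where T: "(U, \<Phi>) \<in> triv L" "x \<in> U"
      using vector_bundleD(2)[OF assms(2)] by blast
    note U = vector_bundleD(3)[OF assms(2) T(1)]
    have "smooth_map_on A U (\<lambda>x. \<Phi> x (b x) *\<^sub>R inverse (\<Phi> x (s x)))"
      by (intro smooth_map_on_scaleR smooth_map_on_inverse assms(1) U sectionsD(2)[OF _ T(1)] s b)
         (rule nonzero[OF T(1)])
    then have "smooth_map_on A U f"
      by (rule smooth_map_on_cong[OF assms(1) U]) (simp add: quotient[OF T(1)])
    then show "\<exists>U. open U \<and> x \<in> U \<and> smooth_map_on A U f"
      using U T(2) by blast
  qed
  moreover have "b = f \<odot> s"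
  proof
    fix x
    show "b x = (f \<odot> s) x"
      unfolding fmult_def using vector_bundleD(2)[OF assms(2), of x] multiple by blast
  qed
  ultimately show ?thesis
    unfolding smooth_functions_def by blast
qed

lemma smooth_if_fmult_section:
  fixes L :: "('m::{t2_space, second_countable_topology}, 'l::real_vector, real) vbundle"
  assumes "smooth_manifold A" "vector_bundle A L"
    and "s \<in> sections A L" "nonvanishing s" "f \<odot> s \<in> sections A L"
  shows "f \<in> smooth_functions A"
  using section_quotient_smooth[OF assms] fmult_cancel[OF assms(4)] by auto


section \<open>The anchor as a derivation\<close>

lemma smooth_function_has_derivative:
  assumes "smooth_manifold A" "f \<in> smooth_functions A" "\<kappa> \<in> A" "x \<in> fst \<kappa>"
  shows "(f \<circ> chart_inv \<kappa> has_derivative frechet_derivative (f \<circ> chart_inv \<kappa>) (at (snd \<kappa> x)))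
    (at (snd \<kappa> x))"
proof (rule Ck_on_Suc_has_derivative)
  show "Ck_on (Suc 0) (snd \<kappa> ` (UNIV \<inter> fst \<kappa>)) (f \<circ> chart_inv \<kappa>)"
    using assms(2,3) unfolding smooth_functions_def smooth_map_on_def smooth_on_def by blast
qed (use assms(4) in auto)

lemma differential_eqI:
  assumes "(h \<circ> chart_inv (chart_at A x) has_derivative h') (at (snd (chart_at A x) x))"
  shows "differential A h x v = (if v \<in> tangent_space A x then h' (v (chart_at A x)) else 0)"
  using frechet_derivative_at[OF assms] by (simp add: differential_def)

lemma differential_const: "differential A (\<lambda>x. c) x v = 0"
  by (subst differential_eqI[where h' = "\<lambda>_. 0"]) (simp_all add: o_def)

context
  fixes A :: "('m::{t2_space, second_countable_topology}, 'c::finite_dim_normed_vector) chart set"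
  assumes A: "smooth_manifold A"
begin

private lemmas chart_derivative = smooth_function_has_derivative[OF A _ chart_at[OF A]]

lemma differential_zero_vector: "f \<in> smooth_functions A \<Longrightarrow> differential A f x 0 = 0"
  using linear_0[OF has_derivative_linear[OF chart_derivative]] by (simp add: differential_def)

lemma differential_add:
  assumes "f \<in> smooth_functions A" "g \<in> smooth_functions A"
  shows "differential A (\<lambda>x. f x + g x) x v = differential A f x v + differential A g x v"
proof -
  have "((\<lambda>x. f x + g x) \<circ> chart_inv (chart_at A x) has_derivative
      (\<lambda>v. frechet_derivative (f \<circ> chart_inv (chart_at A x)) (at (snd (chart_at A x) x)) v +
        frechet_derivative (g \<circ> chart_inv (chart_at A x)) (at (snd (chart_at A x) x)) v))
      (at (snd (chart_at A x) x))"
    using has_derivative_add[OF chart_derivative[OF assms(1), of x]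
        chart_derivative[OF assms(2), of x]]
    by (simp add: o_def)
  from differential_eqI[OF this] show ?thesis
    by (simp add: differential_def)
qed

lemma differential_mult:
  assumes "f \<in> smooth_functions A" "g \<in> smooth_functions A"
  shows "differential A (\<lambda>x. f x * g x) x v =
    f x * differential A g x v + differential A f x v * g x"
proof -
  have "((\<lambda>x. f x * g x) \<circ> chart_inv (chart_at A x) has_derivative
      (\<lambda>v. f x * frechet_derivative (g \<circ> chart_inv (chart_at A x)) (at (snd (chart_at A x) x)) v +
        frechet_derivative (f \<circ> chart_inv (chart_at A x)) (at (snd (chart_at A x) x)) v * g x))
      (at (snd (chart_at A x) x))"
    using has_derivative_mult[OF chart_derivative[OF assms(1), of x]
        chart_derivative[OF assms(2), of x]] chart_inv_chart[OF A chart_at[OF A], of x]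
    by (simp add: o_def)
  from differential_eqI[OF this] show ?thesis
    by (simp add: differential_def)
qed

lemma differential_ln_abs:
  assumes "f \<in> smooth_functions A" "f x \<noteq> 0"
  shows "differential A (\<lambda>x. ln \<bar>f x\<bar>) x v = inverse (f x) * differential A f x v"
proof -
  have "((\<lambda>x. ln \<bar>f x\<bar>) \<circ> chart_inv (chart_at A x) has_derivative
      (\<lambda>v. inverse (f x) *
        frechet_derivative (f \<circ> chart_inv (chart_at A x)) (at (snd (chart_at A x) x)) v))
      (at (snd (chart_at A x) x))"
    using has_derivative_ln_abs[OF chart_derivative[OF assms(1), of x]] assms(2)
      chart_inv_chart[OF A chart_at[OF A], of x]
    by (simp add: o_def)
  from differential_eqI[OF this] show ?thesis
    by (simp add: differential_def)
qed

end

lemma anchor_deriv_const: "anchor_deriv A \<rho> e (\<lambda>x. c) = 0"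
  by (simp add: anchor_deriv_def differential_const fun_eq_iff)

lemma anchor_deriv_add:
  assumes "smooth_manifold A" "f \<in> smooth_functions A" "g \<in> smooth_functions A"
  shows "anchor_deriv A \<rho> e (\<lambda>x. f x + g x) x = anchor_deriv A \<rho> e f x + anchor_deriv A \<rho> e g x"
  using assms by (simp add: anchor_deriv_def differential_add)

lemma anchor_deriv_diff:
  assumes "smooth_manifold A" "f \<in> smooth_functions A" "g \<in> smooth_functions A"
  shows "anchor_deriv A \<rho> e (\<lambda>x. f x - g x) x = anchor_deriv A \<rho> e f x - anchor_deriv A \<rho> e g x"
  using anchor_deriv_add[OF assms(1) smooth_functions_diff[OF assms] assms(3), of \<rho> e x] by simp

lemma anchor_deriv_mult:
  assumes "smooth_manifold A" "f \<in> smooth_functions A" "g \<in> smooth_functions A"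
  shows "anchor_deriv A \<rho> e (\<lambda>x. f x * g x) x =
    f x * anchor_deriv A \<rho> e g x + anchor_deriv A \<rho> e f x * g x"
  using assms by (simp add: anchor_deriv_def differential_mult)

lemma anchor_deriv_ln_abs:
  assumes "smooth_manifold A" "f \<in> smooth_functions A" "nonvanishing f"
  shows "anchor_deriv A \<rho> e (\<lambda>x. ln \<bar>f x\<bar>) x = inverse (f x) * anchor_deriv A \<rho> e f x"
  using assms by (simp add: anchor_deriv_def differential_ln_abs nonvanishing_def)

lemma bilinear_map_onD:
  assumes "bilinear_map_on U V W \<beta>"
  shows "u \<in> U \<Longrightarrow> linear_map_on V W (\<beta> u)" "v \<in> V \<Longrightarrow> linear_map_on U W (\<lambda>u. \<beta> u v)"
  using assms by (auto simp: bilinear_map_on_def)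

lemma loday_algebroidD:
  assumes "loday_algebroid A E br \<rho> \<alpha>"
  shows "vector_bundle A E"
    and "bilinear_map_on (sections A E) (sections A E) (sections A E) br"
    and "e1 \<in> sections A E \<Longrightarrow> e2 \<in> sections A E \<Longrightarrow> e3 \<in> sections A E \<Longrightarrow>
      br e1 (br e2 e3) = br (br e1 e2) e3 + br e2 (br e1 e3)"
    and "linear_map_on (fib E x) (tangent_space A x) (\<rho> x)"
    and "f \<in> smooth_functions A \<Longrightarrow> e1 \<in> sections A E \<Longrightarrow> e2 \<in> sections A E \<Longrightarrow>
      br e1 (f \<odot> e2) = f \<odot> br e1 e2 + anchor_deriv A \<rho> e1 f \<odot> e2"
proof -
  have "vb_morphism A E (tangent_bundle A) \<rho>"
    using assms unfolding loday_algebroid_def by blast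
  then show "linear_map_on (fib E x) (tangent_space A x) (\<rho> x)"
    by (simp add: vb_morphism_def tangent_bundle_def)
qed (use assms in \<open>unfold loday_algebroid_def, blast+\<close>)

text \<open>
  After substituting \<open>f \<odot> e3\<close> for the third section in the Loday identity, all terms cancel except \<open>(\<rho>(e1)\<rho>(e2)f - \<rho>(e2)\<rho>(e1)f - \<rho>([e1,e2])f) \<odot> e3\<close>.  At a point where some
  section \<open>e3\<close> does not vanish this gives the claim.  At a point where every section vanishes the
  claim holds because the three derivatives are taken along \<open>\<rho>(0) = 0\<close>.  The last hypothesis
  allows the Leibniz rule to be applied to the functions \<open>\<rho>(e)(f)\<close>.
\<close>

lemma anchor_deriv_bracket:
  assumes A: "smooth_manifold A" and loday: "loday_algebroid A E br \<rho> \<alpha>"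
    and e: "e1 \<in> sections A E" "e2 \<in> sections A E" and f: "f \<in> smooth_functions A"
    and smooth: "\<And>e g. e \<in> sections A E \<Longrightarrow> g \<in> smooth_functions A \<Longrightarrow>
      anchor_deriv A \<rho> e g \<in> smooth_functions A"
  shows "anchor_deriv A \<rho> (br e1 e2) f x =
    anchor_deriv A \<rho> e1 (anchor_deriv A \<rho> e2 f) x - anchor_deriv A \<rho> e2 (anchor_deriv A \<rho> e1 f) x"
proof -
  note VE = loday_algebroidD(1)[OF loday] and bil = loday_algebroidD(2)[OF loday]
  note rule = loday_algebroidD(5)[OF loday]
  have closed: "br u v \<in> sections A E" if "u \<in> sections A E" "v \<in> sections A E" for u v
    by (rule linear_map_onD(1)[OF bilinear_map_onD(1)[OF bil that(1)] that(2)])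
  have add: "br u (v + w) = br u v + br u w"
    if "u \<in> sections A E" "v \<in> sections A E" "w \<in> sections A E" for u v w
    by (rule linear_map_onD(2)[OF bilinear_map_onD(1)[OF bil that(1)] that(2,3)])
  note fm = sections_fmult[OF A VE]
  let ?X = "anchor_deriv A \<rho> e1" and ?Y = "anchor_deriv A \<rho> e2"
  show ?thesis
  proof (cases "\<exists>e3\<in>sections A E. e3 x \<noteq> 0")
    case True
    then obtain e3 where e3: "e3 \<in> sections A E" "e3 x \<noteq> 0"
      by blast
    have iter: "br u (br v (f \<odot> e3)) =
        (f \<odot> br u (br v e3) + anchor_deriv A \<rho> u f \<odot> br v e3) +
        (anchor_deriv A \<rho> v f \<odot> br u e3 + anchor_deriv A \<rho> u (anchor_deriv A \<rho> v f) \<odot> e3)"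
      if "u \<in> sections A E" "v \<in> sections A E" for u v
      using that f e3(1) by (simp add: rule add fm closed smooth)
    have "br e1 (br e2 (f \<odot> e3)) = br (br e1 e2) (f \<odot> e3) + br e2 (br e1 (f \<odot> e3))"
      by (intro loday_algebroidD(3)[OF loday] e fm f e3)
    then have "(f \<odot> br e1 (br e2 e3) + ?X f \<odot> br e2 e3) + (?Y f \<odot> br e1 e3 + ?X (?Y f) \<odot> e3) =
        (f \<odot> br (br e1 e2) e3 + anchor_deriv A \<rho> (br e1 e2) f \<odot> e3) +
        ((f \<odot> br e2 (br e1 e3) + ?Y f \<odot> br e1 e3) + (?X f \<odot> br e2 e3 + ?Y (?X f) \<odot> e3))"
      unfolding iter[OF e] iter[OF e(2,1)] rule[OF f closed[OF e] e3(1)] .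
    from fun_cong[OF this, of x]
    have "?X (?Y f) x *\<^sub>R e3 x =
        anchor_deriv A \<rho> (br e1 e2) f x *\<^sub>R e3 x + ?Y (?X f) x *\<^sub>R e3 x"
      unfolding loday_algebroidD(3)[OF loday e e3(1)] by (simp add: fmult_def algebra_simps)
    then have "(?X (?Y f) x - anchor_deriv A \<rho> (br e1 e2) f x - ?Y (?X f) x) *\<^sub>R e3 x = 0"
      by (simp add: algebra_simps)
    then show ?thesis
      using e3(2) by simp
  next
    case False
    have "\<rho> x 0 = 0"
      using linear_map_onD(3)[OF loday_algebroidD(4)[OF loday] sectionsD(1)[OF e(1), of x], of 0]
      by simp
    then have zero: "anchor_deriv A \<rho> u g x = 0"
      if "u \<in> sections A E" "g \<in> smooth_functions A" for u g
    proof -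
      have "u x = 0"
        using False that(1) by blast
      then show ?thesis
        using \<open>\<rho> x 0 = 0\<close> differential_zero_vector[OF A that(2)] by (simp add: anchor_deriv_def)
    qed
    show ?thesis
      using zero e f smooth closed by simp
  qed
qed


section \<open>Symbols\<close>

lemma fib_hom_bundle:
  "T \<in> fib (hom_bundle B B') x \<longleftrightarrow>
    linear_map_on (fib B x) (fib B' x) T \<and> (\<forall>v. v \<notin> fib B x \<longrightarrow> T v = 0)"
  by (simp add: hom_bundle_def)

lemma subspace_fib_hom_bundle:
  assumes "subspace (fib B' x)"
  shows "subspace (fib (hom_bundle B B') x)"
proof (rule subspaceI)
  show "0 \<in> fib (hom_bundle B B') x"
    using subspace_0[OF assms] by (simp add: fib_hom_bundle linear_map_on_def)
  show "S + T \<in> fib (hom_bundle B B') x"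
    if "S \<in> fib (hom_bundle B B') x" "T \<in> fib (hom_bundle B B') x" for S T
    using that subspace_add[OF assms]
    by (simp add: fib_hom_bundle linear_map_on_def scaleR_add_right)
  show "c *\<^sub>R T \<in> fib (hom_bundle B B') x" if "T \<in> fib (hom_bundle B B') x" for c T
    using that subspace_scale[OF assms]
    by (simp add: fib_hom_bundle linear_map_on_def scaleR_fun_def scaleR_add_right)
qed

lemma subspace_fib_bilinear_form_bundle: "subspace (fib (bilinear_form_bundle B B') x)"
  unfolding bilinear_form_bundle_def
  by (intro subspace_fib_hom_bundle) (simp add: real_bundle_def)

lemma tensor_in_fib: "tensor B B' x u v \<in> fib (tensor_bundle B B') x"
proof -
  note sub = subspace_fib_bilinear_form_bundle[of B B' x]
  show ?thesis
    unfolding tensor_bundle_def hom_bundle_def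
    by (auto simp: linear_map_on_def tensor_def real_bundle_def scaleR_fun_def
        subspace_add[OF sub] dest: subspace_scale[OF sub])
qed

text \<open>
  Elements of the fibre of a homomorphism bundle are 0 outside the fibre of the source, so \<open>\<beta> u\<close>
  is linear on the fibre of \<open>B'\<close> for every \<open>u\<close>, whether or not \<open>u\<close> lies in the fibre of \<open>B\<close>.
\<close>

lemma tensor_scaleR_right:
  assumes "v \<in> fib B' x"
  shows "tensor B B' x u (c *\<^sub>R v) = c *\<^sub>R tensor B B' x u v"
proof
  fix \<beta>
  show "tensor B B' x u (c *\<^sub>R v) \<beta> = (c *\<^sub>R tensor B B' x u v) \<beta>"
  proof (cases "\<beta> \<in> fib (bilinear_form_bundle B B') x")
    case True
    then have "\<beta> u (c *\<^sub>R v) = c *\<^sub>R \<beta> u v"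
      using assms
      by (cases "u \<in> fib B x") (auto simp: bilinear_form_bundle_def hom_bundle_def linear_map_on_def)
    then show ?thesis
      using True by (simp add: tensor_def scaleR_fun_def)
  qed (simp add: tensor_def scaleR_fun_def)
qed

lemma symbol_apply_fmult:
  assumes "vb_morphism A (tensor_bundle (cotangent_bundle A) E) B' \<sigma>" "e \<in> sections A E"
  shows "symbol_apply A E \<sigma> f (g \<odot> e) b = g \<odot> symbol_apply A E \<sigma> f e b"
proof
  fix x
  have "linear_map_on (fib (tensor_bundle (cotangent_bundle A) E) x) (fib B' x) (\<sigma> x)"
    using assms(1) by (simp add: vb_morphism_def)
  from linear_map_onD(3)[OF this tensor_in_fib]
  show "symbol_apply A E \<sigma> f (g \<odot> e) b x = (g \<odot> symbol_apply A E \<sigma> f e b) x"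
    by (simp add: symbol_apply_def fmult_def tensor_scaleR_right sectionsD(1)[OF assms(2)]
        scaleR_fun_def)
qed


section \<open>Low-degree cochains\<close>

lemma coboundary_wrong_degree:
  assumes D: "D \<in> cochains A E p" and len: "length es \<noteq> Suc p"
  shows "coboundary A E br \<rho> D es = 0"
proof -
  have zero: "D fs = (\<lambda>x. 0)" if "length fs \<noteq> p" for fs
    using D that by (auto simp: cochains_def zero_fun_def)
  have deleted: "D (delete_nth i fs) = (\<lambda>x. 0)" if "i < length fs" "length fs = length es" for i fs
    by (rule zero) (use that len in \<open>simp add: delete_nth_def\<close>)
  have "(\<Sum>i<length es. (-1) ^ i * anchor_deriv A \<rho> (es ! i) (D (delete_nth i es)) x) = 0" for x
    by (simp add: deleted anchor_deriv_const)
  moreover have "(\<Sum>j<length es. \<Sum>i<j.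
      (-1) ^ Suc i * D (delete_nth i (es[j := br (es ! i) (es ! j)])) x) = 0" for x
    by (intro sum.neutral ballI) (simp add: deleted)
  ultimately show ?thesis
    unfolding coboundary_def by (simp only: zero_fun_def add_0 if_cancel)
qed

lemma coboundary_not_sections: "\<not> set es \<subseteq> sections A E \<Longrightarrow> coboundary A E br \<rho> D es = 0"
  by (simp add: coboundary_def zero_fun_def)

lemma coboundary_pair:
  assumes "e1 \<in> sections A E" "e2 \<in> sections A E"
  shows "coboundary A E br \<rho> D [e1, e2] x =
    anchor_deriv A \<rho> e1 (D [e2]) x - anchor_deriv A \<rho> e2 (D [e1]) x - D [br e1 e2] x"
  using assms by (simp add: coboundary_def delete_nth_def numeral_2_eq_2 lessThan_Suc)

lemma cochains_0_eq: "cochains A E 0 = cochain0 ` smooth_functions A"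
proof (intro set_eqI iffI)
  fix D
  assume D: "D \<in> cochains A E 0"
  then have "D = cochain0 (D [])" "D [] \<in> smooth_functions A"
    by (auto simp: cochains_def cochain0_def fun_eq_iff)
  then show "D \<in> cochain0 ` smooth_functions A"
    by blast
qed (auto simp: cochains_def cochain0_def)

lemma coboundary_cochain0:
  assumes "f \<in> smooth_functions A"
  shows "coboundary A E br \<rho> (cochain0 f) es =
    (if length es = 1 \<and> set es \<subseteq> sections A E then anchor_deriv A \<rho> (hd es) f else 0)"
proof (cases "length es = 1 \<and> set es \<subseteq> sections A E")
  case True
  then obtain e where "es = [e]" "e \<in> sections A E"
    by (auto simp: length_Suc_conv)
  then show ?thesis
    by (simp add: coboundary_def delete_nth_def cochain0_def)
next
  case False
  have "cochain0 f \<in> cochains A E 0"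
    using assms by (simp add: cochains_0_eq)
  from coboundary_wrong_degree[OF this] False show ?thesis
    by (cases "set es \<subseteq> sections A E") (auto simp: coboundary_not_sections)
qed

lemma coboundaries_1_diff:
  assumes "smooth_manifold A" "D \<in> coboundaries A E br \<rho> 1" "D' \<in> coboundaries A E br \<rho> 1"
  shows "D - D' \<in> coboundaries A E br \<rho> 1"
proof -
  have cob: "coboundaries A E br \<rho> 1 =
      coboundary A E br \<rho> ` cochain0 ` smooth_functions A"
    by (simp add: coboundaries_def cochains_0_eq)
  obtain f g where fg: "f \<in> smooth_functions A" "g \<in> smooth_functions A"
    and D: "D = coboundary A E br \<rho> (cochain0 f)" "D' = coboundary A E br \<rho> (cochain0 g)"
    using assms(2,3) unfolding cob by blast
  note diff = smooth_functions_diff[OF assms(1) fg]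
  have "D - D' = coboundary A E br \<rho> (cochain0 (\<lambda>x. f x - g x))"
    by (simp add: D fun_eq_iff coboundary_cochain0 fg diff anchor_deriv_diff assms(1))
  then show ?thesis
    using diff unfolding cob by blast
qed

lemma equiv_cohomologous_1:
  assumes "smooth_manifold A"
  shows "equiv (cocycles A E br \<rho> 1) (cohomologous A E br \<rho> 1)"
proof -
  let ?B = "coboundaries A E br \<rho> 1"
  let ?R = "cohomologous A E br \<rho> 1"
  have zero: "0 \<in> ?B"
  proof -
    have "coboundary A E br \<rho> (cochain0 (\<lambda>x. 0)) \<in> ?B"
      using smooth_functions_const[OF assms] by (simp add: coboundaries_def cochains_0_eq)
    from coboundaries_1_diff[OF assms this this] show ?thesis
      by simp
  qed
  show ?thesis
  proof (rule equivI)
    show "?R \<subseteq> cocycles A E br \<rho> 1 \<times> cocycles A E br \<rho> 1"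
      by (auto simp: cohomologous_def)
    show "refl_on (cocycles A E br \<rho> 1) ?R"
      using zero by (simp add: refl_on_def cohomologous_def)
    show "sym ?R"
    proof (rule symI)
      fix D D'
      assume "(D, D') \<in> ?R"
      then show "(D', D) \<in> ?R"
        using coboundaries_1_diff[OF assms zero, of "D - D'"] by (simp add: cohomologous_def)
    qed
    show "trans ?R"
    proof (rule transI)
      fix D D' D''
      assume R: "(D, D') \<in> ?R" "(D', D'') \<in> ?R"
      have "D' - D'' \<in> ?B"
        using R(2) by (simp add: cohomologous_def)
      then have "D'' - D' \<in> ?B"
        using coboundaries_1_diff[OF assms zero, of "D' - D''"] by simp
      then show "(D, D'') \<in> ?R"
        using coboundaries_1_diff[OF assms, of "D - D'" E br \<rho> "D'' - D'"] R
        by (simp add: cohomologous_def)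
    qed
  qed
qed


section \<open>Connections on line bundles\<close>

locale line_bundle_connection =
  fixes A :: "('m::{t2_space, second_countable_topology}, 'c::finite_dim_normed_vector) chart set"
    and E :: "('m, 'e::real_vector, 'f::finite_dim_normed_vector) vbundle"
    and \<rho> :: "'m \<Rightarrow> 'e \<Rightarrow> ('m, 'c) tvector"
    and L :: "('m, 'l::real_vector, real) vbundle"
    and nabla :: "('m \<Rightarrow> 'e) \<Rightarrow> ('m \<Rightarrow> 'l) \<Rightarrow> 'm \<Rightarrow> 'l"
    and s :: "'m \<Rightarrow> 'l"
  assumes A: "smooth_manifold A"
    and VE: "vector_bundle A E"
    and VL: "vector_bundle A L"
    and connection: "nonlinear_connection A E \<rho> L nabla"
    and s: "s \<in> sections A L" "nonvanishing s"
begin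

definition \<theta> :: "('m \<Rightarrow> 'e) \<Rightarrow> 'm \<Rightarrow> real"
  where "\<theta> e = connection_op A E nabla s [e]"

lemma nabla_linear:
  "e \<in> sections A E \<Longrightarrow> linear_map_on (sections A L) (sections A L) (nabla e)"
  "b \<in> sections A L \<Longrightarrow> linear_map_on (sections A E) (sections A L) (\<lambda>e. nabla e b)"
  using connection by (auto simp: nonlinear_connection_def bilinear_map_on_def)

lemma nabla_fmult:
  assumes "f \<in> smooth_functions A" "e \<in> sections A E" "b \<in> sections A L"
  shows "nabla e (f \<odot> b) = f \<odot> nabla e b + anchor_deriv A \<rho> e f \<odot> b"
  using connection assms by (simp add: nonlinear_connection_def)

lemma
  assumes e: "e \<in> sections A E"
  shows nabla_eq_\<theta>: "nabla e s = \<theta> e \<odot> s"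
    and \<theta>_smooth: "\<theta> e \<in> smooth_functions A"
proof -
  have "nabla e s \<in> sections A L"
    by (rule linear_map_onD(1)[OF nabla_linear(1)[OF e] s(1)])
  then obtain f where f: "f \<in> smooth_functions A" "nabla e s = f \<odot> s"
    using section_quotient_smooth[OF A VL s] by blast
  have "\<theta> e = f"
    unfolding \<theta>_def connection_op_def using e f(2) fmult_cancel[OF s(2)] by simp
  then show "nabla e s = \<theta> e \<odot> s" "\<theta> e \<in> smooth_functions A"
    using f by simp_all
qed

lemma \<theta>_eqI: "e \<in> sections A E \<Longrightarrow> nabla e s = f \<odot> s \<Longrightarrow> \<theta> e = f"
  using nabla_eq_\<theta> fmult_cancel[OF s(2)] by metis

text \<open>
  The Leibniz rule of the connection exhibits \<open>\<rho>(e)(f) \<odot> s\<close> as a difference of sections of \<open>L\<close>, and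
  the quotient of a section by \<open>s\<close> is smooth.
\<close>

lemma anchor_deriv_smooth:
  assumes "e \<in> sections A E" "f \<in> smooth_functions A"
  shows "anchor_deriv A \<rho> e f \<in> smooth_functions A"
proof (rule smooth_if_fmult_section[OF A VL s])
  note closed = linear_map_onD(1)[OF nabla_linear(1)[OF assms(1)]]
  have "anchor_deriv A \<rho> e f \<odot> s = nabla e (f \<odot> s) - f \<odot> nabla e s"
    by (simp add: nabla_fmult assms s)
  also have "\<dots> \<in> sections A L"
    by (intro sections_diff sections_fmult A VL closed assms s)
  finally show "anchor_deriv A \<rho> e f \<odot> s \<in> sections A L" .
qed

lemma nabla_fmult_s:
  assumes "e \<in> sections A E" "h \<in> smooth_functions A"
  shows "nabla e (h \<odot> s) = (\<lambda>x. h x * \<theta> e x + anchor_deriv A \<rho> e h x) \<odot> s"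
proof -
  have "nabla e (h \<odot> s) = h \<odot> (\<theta> e \<odot> s) + anchor_deriv A \<rho> e h \<odot> s"
    using assms s by (simp add: nabla_fmult nabla_eq_\<theta>)
  also have "\<dots> = (\<lambda>x. h x * \<theta> e x + anchor_deriv A \<rho> e h x) \<odot> s"
    by (simp add: fmult_def fun_eq_iff scaleR_add_left)
  finally show ?thesis .
qed

text \<open>
  The commutator of \<open>\<theta>\<close> with multiplication by \<open>f\<close> is the coefficient of \<open>\<sigma>(df \<otimes> e)(s)\<close>, which is
  linear over smooth functions in \<open>e\<close>; so \<open>\<theta>\<close> is a differential operator of order at most 1.
\<close>

lemma \<theta>_diff_op: "diff_op A E \<theta>"
proof -
  obtain \<sigma> where \<sigma>: "vb_morphism A (tensor_bundle (cotangent_bundle A) E) (end_bundle L) \<sigma>"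
    and symbol: "\<And>f e b. f \<in> smooth_functions A \<Longrightarrow> e \<in> sections A E \<Longrightarrow> b \<in> sections A L \<Longrightarrow>
      nabla (f \<odot> e) b = f \<odot> nabla e b + symbol_apply A E \<sigma> f e b"
    using connection unfolding nonlinear_connection_def by blast
  have commutator: "(\<theta> (f \<odot> e) - f * \<theta> e) \<odot> s = symbol_apply A E \<sigma> f e s"
    if "f \<in> smooth_functions A" "e \<in> sections A E" for f e
  proof -
    have "symbol_apply A E \<sigma> f e s = nabla (f \<odot> e) s - f \<odot> nabla e s"
      by (simp add: symbol that s)
    also have "\<dots> = \<theta> (f \<odot> e) \<odot> s - f \<odot> (\<theta> e \<odot> s)"
      by (simp add: nabla_eq_\<theta> that sections_fmult[OF A VE])
    finally show ?thesis
      by (simp add: fmult_def fun_eq_iff scaleR_diff_left)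
  qed
  have "\<theta> (f \<odot> (g \<odot> e)) - f * \<theta> (g \<odot> e) = g * (\<theta> (f \<odot> e) - f * \<theta> e)"
    if "f \<in> smooth_functions A" "g \<in> smooth_functions A" "e \<in> sections A E" for f g e
  proof -
    have "(\<theta> (f \<odot> (g \<odot> e)) - f * \<theta> (g \<odot> e)) \<odot> s = g \<odot> symbol_apply A E \<sigma> f e s"
      using that by (simp add: commutator sections_fmult[OF A VE] symbol_apply_fmult[OF \<sigma>])
    also have "\<dots> = g \<odot> ((\<theta> (f \<odot> e) - f * \<theta> e) \<odot> s)"
      using that by (simp add: commutator)
    also have "\<dots> = (g * (\<theta> (f \<odot> e) - f * \<theta> e)) \<odot> s"
      by (simp add: fmult_def fun_eq_iff)
    finally show ?thesis
      by (simp only: fmult_cancel[OF s(2)])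
  qed
  then have "diff_op_order A E (Suc 0) \<theta>"
    by simp
  moreover have "linear_map_on (sections A E) (smooth_functions A) \<theta>"
    unfolding linear_map_on_def
  proof (intro conjI ballI allI)
    note lin = nabla_linear(2)[OF s(1)]
    show "\<theta> (u + v) = \<theta> u + \<theta> v" if "u \<in> sections A E" "v \<in> sections A E" for u v
    proof (rule \<theta>_eqI)
      show "u + v \<in> sections A E"
        by (intro sections_add A VE that)
      show "nabla (u + v) s = (\<theta> u + \<theta> v) \<odot> s"
        using linear_map_onD(2)[OF lin that]
        by (simp add: nabla_eq_\<theta> that fmult_def fun_eq_iff scaleR_add_left)
    qed
    show "\<theta> (c *\<^sub>R v) = c *\<^sub>R \<theta> v" if "v \<in> sections A E" for c v
    proof (rule \<theta>_eqI)
      show "c *\<^sub>R v \<in> sections A E"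
        by (intro sections_scaleR A VE that)
      show "nabla (c *\<^sub>R v) s = (c *\<^sub>R \<theta> v) \<odot> s"
        using linear_map_onD(3)[OF lin that]
        by (simp add: nabla_eq_\<theta> that fmult_def fun_eq_iff scaleR_fun_def)
    qed
  qed (rule \<theta>_smooth)
  ultimately show ?thesis
    unfolding diff_op_def by blast
qed

lemma connection_op_eq:
  "connection_op A E nabla s es = (if length es = 1 \<and> set es \<subseteq> sections A E then \<theta> (hd es) else 0)"
  by (cases es) (auto simp: connection_op_def \<theta>_def)

lemma connection_op_cochain: "connection_op A E nabla s \<in> cochains A E 1"
proof -
  have "connection_op A E nabla s es \<in> smooth_functions A \<and>
      (\<forall>i<1. diff_op A E (\<lambda>e. connection_op A E nabla s (es[i := e])))"
    if es: "length es = 1" "set es \<subseteq> sections A E" for es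
  proof -
    obtain e where "es = [e]" "e \<in> sections A E"
      using es by (cases es) auto
    then show ?thesis
      using \<theta>_smooth \<theta>_diff_op by (simp flip: \<theta>_def)
  qed
  moreover have "connection_op A E nabla s es = 0"
    if "\<not> (length es = 1 \<and> set es \<subseteq> sections A E)" for es
    using that by (simp only: connection_op_eq if_False)
  ultimately show ?thesis
    by (simp only: cochains_def mem_Collect_eq) blast
qed

end

locale loday_line_bundle_connection = line_bundle_connection A E \<rho> L nabla s
  for A :: "('m::{t2_space, second_countable_topology}, 'c::finite_dim_normed_vector) chart set"
    and E :: "('m, 'e::real_vector, 'f::finite_dim_normed_vector) vbundle"
    and \<rho> L nabla s +
  fixes br :: "('m \<Rightarrow> 'e) \<Rightarrow> ('m \<Rightarrow> 'e) \<Rightarrow> 'm \<Rightarrow> 'e"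
    and \<alpha> :: "'m \<Rightarrow> (('m, 'c) covector, 'e) tensors \<Rightarrow> 'e \<Rightarrow> 'e"
  assumes loday: "loday_algebroid A E br \<rho> \<alpha>"
begin

text \<open>
  Write \<open>b = g \<odot> s\<close>.  Expanding the curvature with the Leibniz rule, the products of \<open>\<theta>\<close>-values and
  the first derivatives of \<open>g\<close> cancel in the antisymmetrization; the second derivatives of \<open>g\<close>
  combine to \<open>\<rho>(e1)\<rho>(e2)g - \<rho>(e2)\<rho>(e1)g - \<rho>([e1,e2])g = 0\<close>.  What is left is \<open>g\<close> times the
  coboundary of \<open>\<theta>\<close>.
\<close>

lemma curvature_eq_coboundary:
  assumes e: "e1 \<in> sections A E" "e2 \<in> sections A E" and b: "b \<in> sections A L"
  shows "curvature br nabla e1 e2 b =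
    coboundary A E br \<rho> (connection_op A E nabla s) [e1, e2] \<odot> b"
proof -
  obtain g where g: "g \<in> smooth_functions A" and bg: "b = g \<odot> s"
    using section_quotient_smooth[OF A VL s b] by blast
  have e12: "br e1 e2 \<in> sections A E"
    using linear_map_onD(1)[OF bilinear_map_onD(1)[OF loday_algebroidD(2)[OF loday] e(1)] e(2)] .
  have iterate: "nabla u (nabla v b) = (\<lambda>x.
      (g x * \<theta> v x + anchor_deriv A \<rho> v g x) * \<theta> u x +
      (g x * anchor_deriv A \<rho> u (\<theta> v) x + anchor_deriv A \<rho> u g x * \<theta> v x +
        anchor_deriv A \<rho> u (anchor_deriv A \<rho> v g) x)) \<odot> s"
    if uv: "u \<in> sections A E" "v \<in> sections A E" for u v
  proof -
    note v = \<theta>_smooth[OF uv(2)] anchor_deriv_smooth[OF uv(2) g]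
    note gv = smooth_functions_mult[OF A g v(1)]
    show ?thesis
      unfolding bg nabla_fmult_s[OF uv(2) g] nabla_fmult_s[OF uv(1) smooth_functions_add[OF A gv v(2)]]
      by (simp only: anchor_deriv_add[OF A gv v(2)] anchor_deriv_mult[OF A g v(1)])
  qed
  show ?thesis
  proof
    fix x
    have bracket: "anchor_deriv A \<rho> (br e1 e2) g x =
        anchor_deriv A \<rho> e1 (anchor_deriv A \<rho> e2 g) x - anchor_deriv A \<rho> e2 (anchor_deriv A \<rho> e1 g) x"
      by (rule anchor_deriv_bracket[OF A loday e g anchor_deriv_smooth])
    show "curvature br nabla e1 e2 b x =
        (coboundary A E br \<rho> (connection_op A E nabla s) [e1, e2] \<odot> b) x"
      unfolding curvature_def iterate[OF e] iterate[OF e(2,1)]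
      unfolding bg nabla_fmult_s[OF e12 g]
      by (simp add: bracket fmult_def coboundary_pair[OF e] \<theta>_def[symmetric] algebra_simps)
  qed
qed

lemma representation_iff_cocycle:
  "representation A E br L nabla \<longleftrightarrow> connection_op A E nabla s \<in> cocycles A E br \<rho> 1"
proof
  let ?d = "coboundary A E br \<rho> (connection_op A E nabla s)"
  assume rep: "representation A E br L nabla"
  have "?d es = 0" for es
  proof (cases "length es = 2 \<and> set es \<subseteq> sections A E")
    case True
    then obtain e1 e2 where es: "es = [e1, e2]" and e: "e1 \<in> sections A E" "e2 \<in> sections A E"
      by (auto simp: numeral_2_eq_2 length_Suc_conv)
    have "?d [e1, e2] \<odot> s = 0"
      using rep e s(1) curvature_eq_coboundary[OF e s(1)] by (simp add: representation_def)
    also have "\<dots> = 0 \<odot> s"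
      by (simp add: fmult_def zero_fun_def)
    finally show ?thesis
      by (simp only: es fmult_cancel[OF s(2)])
  next
    case False
    then show ?thesis
      using coboundary_wrong_degree[OF connection_op_cochain] coboundary_not_sections by fastforce
  qed
  then show "connection_op A E nabla s \<in> cocycles A E br \<rho> 1"
    using connection_op_cochain by (simp add: cocycles_def fun_eq_iff)
next
  assume "connection_op A E nabla s \<in> cocycles A E br \<rho> 1"
  then have "coboundary A E br \<rho> (connection_op A E nabla s) = 0"
    by (simp add: cocycles_def)
  then show "representation A E br L nabla"
    by (simp add: representation_def curvature_eq_coboundary) (simp add: fmult_def zero_fun_def)
qed

end

text \<open>
  By the Leibniz rule \<open>\<nabla>\<^sub>e(f \<odot> s) = (f \<theta>\<^sub>s(e) + \<rho>(e)(f)) \<odot> s = (\<theta>\<^sub>s(e) + \<rho>(e)(f) / f) \<odot> (f \<odot> s)\<close>, and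
  \<open>\<rho>(e)(f) / f\<close> is a logarithmic derivative.
\<close>

lemma (in line_bundle_connection) connection_op_change_section:
  assumes s': "s' \<in> sections A L" "nonvanishing s'"
    and f: "f \<in> smooth_functions A" and fs: "s' = f \<odot> s"
  shows "connection_op A E nabla s' =
    connection_op A E nabla s + coboundary A E br \<rho> (cochain0 (\<lambda>x. ln \<bar>f x\<bar>))"
proof
  interpret primed: line_bundle_connection A E \<rho> L nabla s'
    by unfold_locales (fact A VE VL connection s')+
  have nz: "nonvanishing f"
    using s'(2) by (auto simp: fs nonvanishing_def fmult_def)
  have change: "primed.\<theta> e = \<theta> e + anchor_deriv A \<rho> e (\<lambda>x. ln \<bar>f x\<bar>)" if e: "e \<in> sections A E" for e
  proof (rule primed.\<theta>_eqI[OF e])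
    show "nabla e s' = (\<theta> e + anchor_deriv A \<rho> e (\<lambda>x. ln \<bar>f x\<bar>)) \<odot> s'"
    proof
      fix x
      have "f x * \<theta> e x + anchor_deriv A \<rho> e f x =
          (\<theta> e x + inverse (f x) * anchor_deriv A \<rho> e f x) * f x"
        using nz by (simp add: nonvanishing_def field_simps)
      then show "nabla e s' x = ((\<theta> e + anchor_deriv A \<rho> e (\<lambda>x. ln \<bar>f x\<bar>)) \<odot> s') x"
        unfolding fs nabla_fmult_s[OF e f]
        by (simp add: fmult_def anchor_deriv_ln_abs[OF A f nz])
    qed
  qed
  fix es
  show "connection_op A E nabla s' es =
      (connection_op A E nabla s + coboundary A E br \<rho> (cochain0 (\<lambda>x. ln \<bar>f x\<bar>))) es"
  proof (cases "length es = 1 \<and> set es \<subseteq> sections A E")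
    case True
    then obtain e where "es = [e]" "e \<in> sections A E"
      by (cases es) auto
    then show ?thesis
      by (simp add: change connection_op_eq primed.connection_op_eq
          coboundary_cochain0[OF smooth_functions_ln_abs[OF A f nz]])
  next
    case False
    then show ?thesis
      by (simp only: connection_op_eq primed.connection_op_eq if_False plus_fun_apply add_0
          coboundary_cochain0[OF smooth_functions_ln_abs[OF A f nz]])
  qed
qed

theorem proposition4p1:
  fixes A :: "('m::{t2_space, second_countable_topology}, 'c::finite_dim_normed_vector) chart set"
    and E :: "('m, 'e::real_vector, 'f::finite_dim_normed_vector) vbundle"
    and br :: "('m \<Rightarrow> 'e) \<Rightarrow> ('m \<Rightarrow> 'e) \<Rightarrow> 'm \<Rightarrow> 'e"
    and \<rho> :: "'m \<Rightarrow> 'e \<Rightarrow> ('m, 'c) tvector"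
    and \<alpha> :: "'m \<Rightarrow> (('m, 'c) covector, 'e) tensors \<Rightarrow> 'e \<Rightarrow> 'e"
    and L :: "('m, 'l::real_vector, real) vbundle"
    and nabla :: "('m \<Rightarrow> 'e) \<Rightarrow> ('m \<Rightarrow> 'l) \<Rightarrow> 'm \<Rightarrow> 'l"
    and s :: "'m \<Rightarrow> 'l"
  assumes "smooth_manifold A"
    and "loday_algebroid A E br \<rho> \<alpha>"
    and "trivial_line_bundle A L"
    and "nonlinear_connection A E \<rho> L nabla"
    and "s \<in> sections A L" and "nonvanishing s"
  shows "let \<theta> = connection_op A E nabla; d = coboundary A E br \<rho> in
    (\<theta> s \<in> cochains A E 1 \<and> (\<forall>e\<in>sections A E. nabla e s = \<theta> s [e] \<odot> s)) \<and>
    (\<forall>e1\<in>sections A E. \<forall>e2\<in>sections A E.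
      curvature br nabla e1 e2 s = d (\<theta> s) [e1, e2] \<odot> s \<and>
      (\<forall>b\<in>sections A L. curvature br nabla e1 e2 b = d (\<theta> s) [e1, e2] \<odot> b)) \<and>
    (representation A E br L nabla \<longleftrightarrow> \<theta> s \<in> cocycles A E br \<rho> 1) \<and>
    (\<forall>s'\<in>sections A L. nonvanishing s' \<longrightarrow>
      (\<exists>f\<in>smooth_functions A. nonvanishing f \<and> s' = f \<odot> s \<and>
        (\<lambda>x. ln \<bar>f x\<bar>) \<in> smooth_functions A \<and>
        \<theta> s' = \<theta> s + d (cochain0 (\<lambda>x. ln \<bar>f x\<bar>)))) \<and>
    (representation A E br L nabla \<longrightarrow>
      cohomology_class A E br \<rho> 1 (\<theta> s) \<in> cohomology A E br \<rho> 1 \<and>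
      (\<forall>s'\<in>sections A L. nonvanishing s' \<longrightarrow>
        cohomology_class A E br \<rho> 1 (\<theta> s') = cohomology_class A E br \<rho> 1 (\<theta> s)))"
proof -
  have VE: "vector_bundle A E" and VL: "vector_bundle A L"
    using assms(2,3) by (auto simp: loday_algebroid_def trivial_line_bundle_def)
  have loc: "loday_line_bundle_connection A E \<rho> L nabla t br \<alpha>"
    if "t \<in> sections A L" "nonvanishing t" for t
    by unfold_locales (fact assms VE VL that)+
  interpret loday_line_bundle_connection A E \<rho> L nabla s br \<alpha>
    by (rule loc[OF assms(5,6)])
  let ?\<theta> = "connection_op A E nabla" and ?d = "coboundary A E br \<rho>"
  have change: "\<exists>f\<in>smooth_functions A. nonvanishing f \<and> s' = f \<odot> s \<and>
      (\<lambda>x. ln \<bar>f x\<bar>) \<in> smooth_functions A \<and>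
      ?\<theta> s' = ?\<theta> s + ?d (cochain0 (\<lambda>x. ln \<bar>f x\<bar>))"
    if s': "s' \<in> sections A L" "nonvanishing s'" for s'
  proof -
    obtain f where f: "f \<in> smooth_functions A" "s' = f \<odot> s"
      using section_quotient_smooth[OF A VL s s'(1)] by blast
    have nz: "nonvanishing f"
      using s'(2) by (auto simp: f(2) nonvanishing_def fmult_def)
    show ?thesis
      using f nz smooth_functions_ln_abs[OF A f(1) nz] connection_op_change_section[OF s' f] by blast
  qed
  have class_eq: "cohomology_class A E br \<rho> 1 (?\<theta> s') = cohomology_class A E br \<rho> 1 (?\<theta> s)"
    if rep: "representation A E br L nabla" and s': "s' \<in> sections A L" "nonvanishing s'" for s'
  proof -
    interpret primed: loday_line_bundle_connection A E \<rho> L nabla s' br \<alpha>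
      by (rule loc[OF s'])
    obtain g where "g \<in> smooth_functions A" "?\<theta> s' = ?\<theta> s + ?d (cochain0 g)"
      using change[OF s'] by blast
    then have "?\<theta> s' - ?\<theta> s \<in> coboundaries A E br \<rho> 1"
      by (simp add: coboundaries_def cochains_0_eq)
    then have "(?\<theta> s', ?\<theta> s) \<in> cohomologous A E br \<rho> 1"
      using rep representation_iff_cocycle primed.representation_iff_cocycle
      by (simp add: cohomologous_def)
    then show ?thesis
      unfolding cohomology_class_def by (rule equiv_class_eq[OF equiv_cohomologous_1[OF A]])
  qed
  have "cohomology_class A E br \<rho> 1 (?\<theta> s) \<in> cohomology A E br \<rho> 1"
    if "representation A E br L nabla"
    using that unfolding cohomology_class_def cohomology_def representation_iff_cocycle
    by (rule quotientI)
  then show ?thesis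
    unfolding Let_def
    using connection_op_cochain nabla_eq_\<theta>[unfolded \<theta>_def] curvature_eq_coboundary s(1)
      representation_iff_cocycle change class_eq
    by blast
qed

end
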